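(* Let $\lambda=\lambda_1\varpi_1+\lambda_2\varpi_2$ be a dominant weight of type $C_2$. The map $\overline\Psi:\mathcal{P}(\lambda)\to\mathcal{P}(\lambda+\varpi_2)$ is injective and weight preserving. If $\lambda_1\ne0$, then $\mathcal{A}(\lambda+\varpi_2):=\mathcal{P}(\lambda+\varpi_2)\setminus\overline\Psi(\mathcal{P}(\lambda))$ is an atom. If $\lambda_1=0$, then $\mathcal{A}(\lambda+2\varpi_2):=\mathcal{P}(\lambda+2\varpi_2)\setminus\overline\Psi^2(\mathcal{P}(\lambda))$ is an atom.
   Context: **Root data (type $C_2$).** $X=\mathbb{Z}\varpi_1\oplus\mathbb{Z}\varpi_2$ is the weight lattice of $Sp_4(\mathbb{C})$, $\mu=(\mu_1,\mu_2)=\mu_1\varpi_1+\mu_2\varpi_2$, $X_+=\{\mu:\mu_1,\mu_2\ge 0\}$; simple roots $\alpha_1=2\varpi_1-\varpi_2$, $\alpha_2=-2\varpi_1+2\varpi_2$; $W$ is generated by $s_1(\mu)=(-\mu_1,\mu_1+\mu_2)$ and $s_2(\mu)=(\mu_1+2\mu_2,-\mu_2)$. For $\nu\in X_+$, $\mu\le\nu$ means $\mu\in\mathrm{Conv}(W\nu)\cap(\nu+\mathbb{Z}\Phi)$. **Crystals.** $\mathcal{B}(\lambda)$ is the (normal) crystal of the irreducible $\mathfrak{sp}_4$-module of highest weight $\lambda$, with operators $e_i,f_i$ ($i=1,2$); $s_1$ acts on it by reversing each $f_1$-string. For $T\in\mathcal{B}(\lambda)$, $\mathrm{str}_2(T)=(a,b,c,d)$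 is the adapted string for $s_2s_1s_2s_1$: $a=\varepsilon_2(T)$, $b=\varepsilon_1(e_2^aT)$, $c=\varepsilon_2(e_1^be_2^aT)$, $d=\varepsilon_1(e_2^ce_1^be_2^aT)$; it determines $T$. There is an injective weight-preserving map $\Phi:\mathcal{B}(\lambda)\to\mathcal{B}(\lambda+2\varpi_1)$ with $\mathrm{str}_2(\Phi(T))=\mathrm{str}_2(T)+(0,1,1,1)$. Principal preatom: $\mathcal{P}(\lambda)=\mathcal{B}(\lambda)\setminus\Phi(\mathcal{B}(\lambda-2\varpi_1))$ if $\lambda_1\ge2$, and $\mathcal{P}(\lambda)=\mathcal{B}(\lambda)$ if $\lambda_1\le 1$; it is stable under $s_1$. **The map $\overline\Psi$.** For $T\in\mathcal{P}(\lambda)$ with $\mathrm{str}_2(T)=(a,b,c,d)$, $\Psi(T)\in\mathcal{P}(\lambda+\varpi_2)$ is the (existing) element with $\mathrm{str}_2(\Psi(T))=(a,b+1,c+1,d)$ if $d\in\{0,\lambda_1\}$ and $\mathrm{str}_2(\Psi(T))=(a,b,c+1,d+1)$ otherwise. $\overline\Psi(T)=\Psi(T)$ if $\mathrm{wt}(T)_1\le0$ and $\overline\Psi(T)=s_1(\Psi(s_1(T)))$ if $\mathrm{wt}(T)_1\ge0$. $\overline\Psi^2$ denotes the composite $\mathcal{P}(\lambda)\to\mathcal{P}(\lambda+\varpi_2)\to\mathcal{P}(\lambda+2\varpi_2)$. **Atom.** A subset $A$ of a crystal $\mathcal{B}(\lambda)$ is an atom if there is $\nu\in X_+$ such that the weights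 of elements of $A$ are exactly the weights $\mu\le\nu$, each occurring exactly once. *)

theory Defs
  imports "HOL-Analysis.Analysis"
begin

section \<open>Root data of type C2\<close>

text \<open>The weight \<open>(\<mu>\<^sub>1, \<mu>\<^sub>2)\<close> stands for \<open>\<mu>\<^sub>1 \<varpi>\<^sub>1 + \<mu>\<^sub>2 \<varpi>\<^sub>2\<close>.\<close>

type_synonym weight = "int \<times> int"

datatype index = I1 | I2

definition varpi1 :: weight where "varpi1 = (1, 0)"
definition varpi2 :: weight where "varpi2 = (0, 1)"

definition dominant :: "weight set" where
  "dominant = {\<mu>. 0 \<le> fst \<mu> \<and> 0 \<le> snd \<mu>}"

fun simple_root :: "index \<Rightarrow> weight" where
  "simple_root I1 = (2, -1)"
| "simple_root I2 = (-2, 2)"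

definition root_lattice :: "weight set" where
  "root_lattice = {(m * fst (simple_root I1) + n * fst (simple_root I2),
                    m * snd (simple_root I1) + n * snd (simple_root I2)) | m n. True}"

fun refl :: "index \<Rightarrow> weight \<Rightarrow> weight" where
  "refl I1 (m1, m2) = (- m1, m1 + m2)"
| "refl I2 (m1, m2) = (m1 + 2 * m2, - m2)"

text \<open>Simple reflections are involutions, so the monoid they generate is the group \<open>W\<close>.\<close>

inductive_set weyl_group :: "(weight \<Rightarrow> weight) set" where
  weyl_id: "id \<in> weyl_group"
| weyl_refl: "w \<in> weyl_group \<Longrightarrow> refl i \<circ> w \<in> weyl_group"

definition weyl_orbit :: "weight \<Rightarrow> weight set" where
  "weyl_orbit \<nu> = (\<lambda>w. w \<nu>) ` weyl_group"

definition real_weight :: "weight \<Rightarrow> real \<times> real" where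
  "real_weight \<mu> = (real_of_int (fst \<mu>), real_of_int (snd \<mu>))"

text \<open>The order \<open>\<mu> \<le> \<nu>\<close>, used for dominant \<open>\<nu>\<close>.\<close>

definition weight_le :: "weight \<Rightarrow> weight \<Rightarrow> bool" where
  "weight_le \<mu> \<nu> \<longleftrightarrow>
     real_weight \<mu> \<in> convex hull (real_weight ` weyl_orbit \<nu>) \<and> \<mu> - \<nu> \<in> root_lattice"


section \<open>The crystals\<close>

text \<open>
  The crystal of the irreducible module of highest weight \<open>\<lambda>\<close> is realised as in Kashiwara and
  Nakashima: as the connected component of a highest weight element of weight \<open>\<lambda>\<close> in a tensor
  power of the crystal \<open>1 \<rightarrow> 2 \<rightarrow> 2bar \<rightarrow> 1bar\<close> (arrows coloured 1, 2, 1) of the four-dimensional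
  vector representation. The word \<open>[x\<^sub>1, \<dots>, x\<^sub>n]\<close> stands for \<open>x\<^sub>1 \<otimes> \<dots> \<otimes> x\<^sub>n\<close>, with Kashiwara's
  convention for the tensor product, and \<open>None\<close> stands for the value 0 of a crystal operator.
\<close>

datatype letter = One | Two | TwoBar | OneBar

fun f_letter :: "index \<Rightarrow> letter \<Rightarrow> letter option" where
  "f_letter I1 One = Some Two"
| "f_letter I2 Two = Some TwoBar"
| "f_letter I1 TwoBar = Some OneBar"
| "f_letter _ _ = None"

fun e_letter :: "index \<Rightarrow> letter \<Rightarrow> letter option" where
  "e_letter I1 Two = Some One"
| "e_letter I2 TwoBar = Some Two"
| "e_letter I1 OneBar = Some TwoBar"
| "e_letter _ _ = None"

text \<open>All strings in the vector crystal have length at most 1.\<close>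

definition eps_letter :: "index \<Rightarrow> letter \<Rightarrow> nat" where
  "eps_letter i x = (if e_letter i x = None then 0 else 1)"

definition phi_letter :: "index \<Rightarrow> letter \<Rightarrow> nat" where
  "phi_letter i x = (if f_letter i x = None then 0 else 1)"

fun wt_letter :: "letter \<Rightarrow> weight" where
  "wt_letter One = (1, 0)"
| "wt_letter Two = (-1, 1)"
| "wt_letter TwoBar = (1, -1)"
| "wt_letter OneBar = (-1, 0)"

type_synonym word = "letter list"

definition wt :: "word \<Rightarrow> weight" where
  "wt w = sum_list (map wt_letter w)"

text \<open>
  The tensor product rule
  \<open>\<epsilon>\<^sub>i(b \<otimes> c) = \<epsilon>\<^sub>i(b) + max 0 (\<epsilon>\<^sub>i(c) - \<phi>\<^sub>i(b))\<close> and
  \<open>\<phi>\<^sub>i(b \<otimes> c) = \<phi>\<^sub>i(c) + max 0 (\<phi>\<^sub>i(b) - \<epsilon>\<^sub>i(c))\<close>;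
  the truncated subtraction of natural numbers supplies the maximum.
\<close>

fun eps :: "index \<Rightarrow> word \<Rightarrow> nat" where
  "eps i [] = 0"
| "eps i (x # w) = eps_letter i x + (eps i w - phi_letter i x)"

fun phi :: "index \<Rightarrow> word \<Rightarrow> nat" where
  "phi i [] = 0"
| "phi i (x # w) = phi i w + (phi_letter i x - eps i w)"

fun f_op :: "index \<Rightarrow> word \<Rightarrow> word option" where
  "f_op i [] = None"
| "f_op i (x # w) =
     (if phi_letter i x > eps i w then map_option (\<lambda>y. y # w) (f_letter i x)
      else map_option (\<lambda>v. x # v) (f_op i w))"

fun e_op :: "index \<Rightarrow> word \<Rightarrow> word option" where
  "e_op i [] = None"
| "e_op i (x # w) =
     (if phi_letter i x \<ge> eps i w then map_option (\<lambda>y. y # w) (e_letter i x)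
      else map_option (\<lambda>v. x # v) (e_op i w))"

text \<open>Every prefix of this word has dominant weight, so it is annihilated by \<open>e\<^sub>1\<close> and \<open>e\<^sub>2\<close>.\<close>

definition highest_word :: "weight \<Rightarrow> word" where
  "highest_word lam =
     replicate (nat (fst lam)) One @ concat (replicate (nat (snd lam)) [One, Two])"

inductive_set crystal :: "weight \<Rightarrow> word set" for lam :: weight where
  crystal_highest: "highest_word lam \<in> crystal lam"
| crystal_f: "\<lbrakk>T \<in> crystal lam; f_op i T = Some T'\<rbrakk> \<Longrightarrow> T' \<in> crystal lam"
| crystal_e: "\<lbrakk>T \<in> crystal lam; e_op i T = Some T'\<rbrakk> \<Longrightarrow> T' \<in> crystal lam"

text \<open>The powers below are only meaningful for \<open>n \<le> \<epsilon>\<^sub>i(T)\<close> and \<open>n \<le> \<phi>\<^sub>i(T)\<close> respectively.\<close>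

definition e_pow :: "index \<Rightarrow> nat \<Rightarrow> word \<Rightarrow> word" where
  "e_pow i n T = ((\<lambda>v. the (e_op i v)) ^^ n) T"

definition f_pow :: "index \<Rightarrow> nat \<Rightarrow> word \<Rightarrow> word" where
  "f_pow i n T = ((\<lambda>v. the (f_op i v)) ^^ n) T"

text \<open>
  Reversal of the \<open>1\<close>-string through \<open>T\<close>: the image lies \<open>\<phi>\<^sub>1(T)\<close> steps below the top of the string.
\<close>

definition s1_crystal :: "word \<Rightarrow> word" where
  "s1_crystal T =
     (if eps I1 T \<le> phi I1 T then f_pow I1 (phi I1 T - eps I1 T) T
      else e_pow I1 (eps I1 T - phi I1 T) T)"

definition str2 :: "word \<Rightarrow> nat \<times> nat \<times> nat \<times> nat" where
  "str2 T =
     (let a = eps I2 T; T1 = e_pow I2 a T;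
          b = eps I1 T1; T2 = e_pow I1 b T1;
          c = eps I2 T2; T3 = e_pow I2 c T2;
          d = eps I1 T3
      in (a, b, c, d))"


section \<open>Principal preatoms, the map on them, and atoms\<close>

text \<open>
  An element of \<open>crystal lam\<close> is determined by its adapted string, so \<open>Phi_map\<close> and \<open>Psi_map\<close> pick
  the unique element with the prescribed string.
\<close>

definition Phi_map :: "weight \<Rightarrow> word \<Rightarrow> word" where
  "Phi_map lam T =
     (THE T'. T' \<in> crystal (lam + varpi1 + varpi1) \<and> str2 T' = str2 T + (0, 1, 1, 1))"

definition preatom :: "weight \<Rightarrow> word set" where
  "preatom lam =
     (if fst lam \<ge> 2
      then crystal lam - Phi_map (lam - varpi1 - varpi1) ` crystal (lam - varpi1 - varpi1)
      else crystal lam)"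

definition Psi_string :: "weight \<Rightarrow> nat \<times> nat \<times> nat \<times> nat \<Rightarrow> nat \<times> nat \<times> nat \<times> nat" where
  "Psi_string lam s =
     (case s of (a, b, c, d) \<Rightarrow>
        if int d \<in> {0, fst lam} then (a, b + 1, c + 1, d) else (a, b, c + 1, d + 1))"

definition Psi_map :: "weight \<Rightarrow> word \<Rightarrow> word" where
  "Psi_map lam T =
     (THE T'. T' \<in> preatom (lam + varpi2) \<and> str2 T' = Psi_string lam (str2 T))"

text \<open>
  If the first coordinate of the weight vanishes then \<open>s1_crystal\<close> fixes both \<open>T\<close> and
  \<open>Psi_map lam T\<close>, so the two branches agree.
\<close>

definition Psi_bar :: "weight \<Rightarrow> word \<Rightarrow> word" where
  "Psi_bar lam T =
     (if fst (wt T) \<le> 0 then Psi_map lam T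
      else s1_crystal (Psi_map lam (s1_crystal T)))"

definition is_atom :: "weight \<Rightarrow> word set \<Rightarrow> bool" where
  "is_atom lam A \<longleftrightarrow>
     A \<subseteq> crystal lam \<and> (\<exists>\<nu> \<in> dominant. bij_betw wt A {\<mu>. weight_le \<mu> \<nu>})"

end

theory Submission
  imports Defs
begin

text \<open>
  Kashiwara-Nakashima tableaux parametrise the crystal explicitly, and reading off adapted strings
  identifies it with the lattice points of a string cone. In these coordinates the weight is
  linear, the preatom and \<open>\<Psi>\<close> are given by linear conditions, and the strings outside
  the image of \<open>\<Psi>\<close> (for \<open>\<lambda>\<^sub>1 = 0\<close>, of \<open>\<Psi>\<^sup>2\<close>) can be listed: for every
  \<open>x\<close> there is exactly one family of them with weight \<open>\<nu> - x \<alpha>\<^sub>1 - y \<alpha>\<^sub>2\<close>, and its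
  values of \<open>y\<close> sweep the corresponding line of the octagon \<open>Conv(W \<nu>)\<close> once. Passing
  from \<open>\<Psi>\<close> to its symmetrised version changes nothing on the half with
  \<open>wt\<^sub>1 \<le> 0\<close> and reflects it to the other half, so the conclusion survives because the octagon
  and the preatom are stable under \<open>s\<^sub>1\<close>.
\<close>

section \<open>Words\<close>

text \<open>Two obstacles shape the argument. \<open>Phi_map\<close> and \<open>Psi_map\<close> are
  definite descriptions, so any statement about them first needs \<open>str2\<close> to be a
  bijection from the crystal onto an explicit set of quadruples; hence the explicit inverse on
  tableaux. And adapted strings begin with \<epsilon>_2, which makes reversal of 1-strings awkward
  to express in them, whereas on tableaux \<epsilon>_1 and \<phi>_1 are short formulas. So stability
  under s_1 is settled on tableaux, and the counting on strings. The weight \<nu> of the atom is the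
  highest weight of the surrounding crystal. For \<lambda>_1 = 0 the fourth coordinate is always 0,
  and a single step omits only the strings with b = 2 c, in whose weights \<alpha>_1 is subtracted
  an even number of times; the second step supplies the odd ones.\<close>

lemma eps_append: "eps i (u @ v) = eps i u + (eps i v - phi i u)"
  and phi_append: "phi i (u @ v) = phi i v + (phi i u - eps i v)"
proof (induction u)
  case (Cons x u)
  case 1 show ?case using Cons by simp
  case 2 show ?case using Cons by simp
qed simp_all

lemma e_op_eq_None_iff: "e_op i w = None \<longleftrightarrow> eps i w = 0"
  by (induction w) (auto simp: eps_letter_def)

lemma f_op_eq_None_iff: "f_op i w = None \<longleftrightarrow> phi i w = 0"
  by (induction w) (auto simp: phi_letter_def)

text \<open>The rule for one letter holds for any factorisation of a word: this is associativity of
  the tensor product. A tie goes to the left factor here and to the right factor for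
  \<open>f_op\<close>, as it must for the two operators to be mutually inverse.\<close>

lemma e_op_append:
  "e_op i (u @ v) = (if eps i v \<le> phi i u then map_option (\<lambda>u'. u' @ v) (e_op i u)
     else map_option (\<lambda>v'. u @ v') (e_op i v))"
proof (induction u)
  case Nil
  show ?case
    using e_op_eq_None_iff[of i v] by (cases "e_op i v") auto
next
  case (Cons x u)
  then show ?case
    by (auto simp: eps_append option.map_comp comp_def)
qed

lemma f_op_append:
  "f_op i (u @ v) = (if eps i v < phi i u then map_option (\<lambda>u'. u' @ v) (f_op i u)
     else map_option (\<lambda>v'. u @ v') (f_op i v))"
proof (induction u)
  case Nil
  show ?case
    by (cases "f_op i v") auto
next
  case (Cons x u)
  then show ?case
    by (auto simp: eps_append option.map_comp comp_def)
qed

lemma letter_inverse: "e_letter i x = Some y \<longleftrightarrow> f_letter i y = Some x"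
  by (cases i; cases x; cases y; simp)

lemma letter_string:
  assumes "f_letter i x = Some y"
  shows "eps_letter i x = 0" "phi_letter i x = 1" "eps_letter i y = 1" "phi_letter i y = 0"
    "wt_letter y = wt_letter x - simple_root i"
  using assms by (cases i; cases x; auto simp: eps_letter_def phi_letter_def)+

lemma wt_Cons: "wt (x # w) = wt_letter x + wt w"
  by (simp add: wt_def)

lemma wt_append: "wt (u @ v) = wt u + wt v"
  by (simp add: wt_def)

lemma f_op_eps_phi:
  "f_op i w = Some w' \<Longrightarrow> eps i w' = Suc (eps i w) \<and> phi i w = Suc (phi i w') \<and> e_op i w' = Some w
     \<and> wt w' = wt w - simple_root i"
proof (induction w arbitrary: w')
  case (Cons x w)
  show ?case
  proof (cases "eps i w < phi_letter i x")
    case True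
    then obtain y where y: "f_letter i x = Some y" "w' = y # w"
      using Cons.prems by auto
    show ?thesis
      using True y letter_string[OF y(1)] letter_inverse[of i y x] by (simp add: wt_Cons algebra_simps)
  next
    case False
    then obtain v where v: "f_op i w = Some v" "w' = x # v"
      using Cons.prems by auto
    have "phi_letter i x \<le> 1"
      by (simp add: phi_letter_def)
    then show ?thesis
      using False v Cons.IH[OF v(1)] by (auto simp: wt_Cons algebra_simps)
  qed
qed simp

lemma e_op_imp_f_op: "e_op i w = Some w' \<Longrightarrow> f_op i w' = Some w"
proof (induction w arbitrary: w')
  case (Cons x w)
  show ?case
  proof (cases "eps i w \<le> phi_letter i x")
    case True
    then obtain y where y: "e_letter i x = Some y" "w' = y # w"
      using Cons.prems by auto
    then have "f_letter i y = Some x" by (simp add: letter_inverse)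
    from letter_string[OF this] this show ?thesis
      using True y by simp
  next
    case False
    then obtain v where v: "e_op i w = Some v" "w' = x # v"
      using Cons.prems by auto
    from f_op_eps_phi[OF Cons.IH[OF v(1)]] show ?thesis
      using False v Cons.IH[OF v(1)] by auto
  qed
qed simp

lemma f_op_iff_e_op: "f_op i w = Some w' \<longleftrightarrow> e_op i w' = Some w"
  using f_op_eps_phi e_op_imp_f_op by blast

text \<open>The first coordinate is the pairing with the coroot of \<alpha>_1; this is why string
  reversal acts on weights as \<open>refl I1\<close>.\<close>

lemma phi_minus_eps: "int (phi I1 w) - int (eps I1 w) = fst (wt w)"
proof (induction w)
  case (Cons x w)
  then show ?case
    by (cases x) (auto simp: wt_Cons eps_letter_def phi_letter_def)
qed (simp add: wt_def)

section \<open>Runs of equal columns\<close>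

definition pw :: "nat \<Rightarrow> word \<Rightarrow> word" where
  "pw n X = concat (replicate n X)"

lemma pw_0: "pw 0 X = []"
  and pw_Suc: "pw (Suc n) X = X @ pw n X"
  by (simp_all add: pw_def)

lemma pw_Suc_right: "pw (Suc n) X = pw n X @ X"
  by (induction n) (simp_all add: pw_0 pw_Suc)

lemma wt_pw: "wt (pw n X) = (int n * fst (wt X), int n * snd (wt X))"
  by (induction n) (auto simp: pw_0 pw_Suc wt_append wt_def[of "[]"] algebra_simps prod_eq_iff)

lemma eps_phi_pw:
  assumes "phi i X = 0"
  shows "eps i (pw n X) = n * eps i X" "phi i (pw n X) = 0"
  using assms by (induction n) (simp_all add: pw_0 pw_Suc eps_append phi_append)

lemma eps_phi_pw':
  assumes "eps i X = 0"
  shows "eps i (pw n X) = 0" "phi i (pw n X) = n * phi i X"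
  using assms by (induction n) (simp_all add: pw_0 pw_Suc eps_append phi_append)

text \<open>A column changed by an operator always borders the run of its new kind. These rules
  absorb it there, so that the result is literally a \<open>tab\<close> again.\<close>

lemma pw_fold:
  "x # pw n [x] = pw (Suc n) [x]"
  "x # pw n [x] @ w = pw (Suc n) [x] @ w"
  "pw n [x] @ x # w = pw (Suc n) [x] @ w"
  "x # y # pw n [x, y] = pw (Suc n) [x, y]"
  "x # y # pw n [x, y] @ w = pw (Suc n) [x, y] @ w"
  "pw n [x, y] @ x # y # w = pw (Suc n) [x, y] @ w"
proof -
  show "pw n [x] @ x # w = pw (Suc n) [x] @ w" "pw n [x, y] @ x # y # w = pw (Suc n) [x, y] @ w"
    by (simp_all add: pw_Suc_right)
qed (simp_all add: pw_Suc)

text \<open>Copies with \<open>phi = 0\<close> cancel nothing to their right, so raising acts on the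
  last copy. Dually, lowering acts on the first copy when \<open>eps = 0\<close>.\<close>

lemma e_op_pw:
  assumes "phi i X = 0"
  shows "e_op i (pw n X) = (if n = 0 then None else map_option ((@) (pw (n - 1) X)) (e_op i X))"
proof (cases "n = 0 \<or> eps i X = 0")
  case True
  then have "n = 0 \<or> e_op i X = None \<and> e_op i (pw n X) = None"
    using assms by (simp add: e_op_eq_None_iff eps_phi_pw)
  then show ?thesis
    by (auto simp: pw_0)
next
  case False
  then obtain m where "n = Suc m"
    by (cases n) auto
  then show ?thesis
    using assms False by (simp add: pw_Suc_right e_op_append eps_phi_pw)
qed

lemma f_op_pw:
  assumes "eps i X = 0"
  shows "f_op i (pw n X) = (if n = 0 then None else map_option (\<lambda>Y. Y @ pw (n - 1) X) (f_op i X))"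
proof (cases "n = 0 \<or> phi i X = 0")
  case True
  then have "n = 0 \<or> f_op i X = None \<and> f_op i (pw n X) = None"
    using assms by (simp add: f_op_eq_None_iff eps_phi_pw')
  then show ?thesis
    by (auto simp: pw_0)
next
  case False
  then obtain m where "n = Suc m"
    by (cases n) auto
  then show ?thesis
    using assms False by (simp add: pw_Suc f_op_append eps_phi_pw')
qed

section \<open>Tableaux\<close>

text \<open>
  The column reading, from right to left, of a two-row tableau. Of the columns of length two,
  \<open>[Two, TwoBar]\<close> may occur at most once; the other conditions in \<open>admissible\<close> are
  Kashiwara and Nakashima's compatibility conditions between neighbouring columns.
\<close>

definition tab :: "nat \<Rightarrow> nat \<Rightarrow> nat \<Rightarrow> nat \<Rightarrow> nat \<Rightarrow> nat \<Rightarrow> nat \<Rightarrow> nat \<Rightarrow> nat \<Rightarrow> word" where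
  "tab s r q p e d c b a =
     pw s [OneBar] @ pw r [TwoBar] @ pw q [Two] @ pw p [One] @ pw e [TwoBar, OneBar] @
     pw d [Two, OneBar] @ pw c [Two, TwoBar] @ pw b [One, TwoBar] @ pw a [One, Two]"

definition admissible :: "nat \<Rightarrow> nat \<Rightarrow> nat \<Rightarrow> nat \<Rightarrow> nat \<Rightarrow> bool" where
  "admissible q p e d c \<longleftrightarrow> c \<le> 1 \<and> (0 < p \<longrightarrow> c = 0 \<and> d = 0 \<and> e = 0) \<and> (0 < q \<longrightarrow> e = 0)"

lemma wt_tab:
  "wt (tab s r q p e d c b a) =
     (int p - int q + int r - int s + 2 * int b - 2 * int d,
      int q - int r + int a - int b + int d - int e)"
  by (simp add: tab_def wt_append wt_pw wt_Cons) (simp add: wt_def)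

lemmas word_simps = eps_append phi_append eps_phi_pw eps_phi_pw' e_op_append f_op_append
  e_op_pw f_op_pw eps_letter_def phi_letter_def

text \<open>\<open>[Two, TwoBar]\<close> is the only column with both \<open>eps I1\<close> and
  \<open>phi I1\<close> nonzero, so the rules for runs do not cover it. Since it occurs at most
  once, cases suffice.\<close>

lemma middle_column:
  assumes "c \<le> 1"
  shows "eps I1 (pw c [Two, TwoBar]) = c" "phi I1 (pw c [Two, TwoBar]) = c"
    "e_op I1 (pw c [Two, TwoBar]) = (if c = 0 then None else Some [One, TwoBar])"
    "f_op I1 (pw c [Two, TwoBar]) = (if c = 0 then None else Some [Two, OneBar])"
  using assms by (cases c; simp add: pw_0 pw_Suc eps_letter_def phi_letter_def)+

lemma middle_column_eqs:
  "pw 0 [Two, TwoBar] = []"  "pw (Suc 0) [Two, TwoBar] = [Two, TwoBar]"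
  by (simp_all add: pw_0 pw_Suc)

text \<open>The truncated differences are what survives bracketing. Admissibility rules out two
  further cancellations: of \<open>p\<close> against \<open>d\<close> and \<open>c\<close> for index
  1, and of \<open>q\<close> against \<open>e\<close> for index 2.\<close>

lemma eps_phi_tab:
  assumes "admissible q p e d c"
  shows "eps I1 (tab s r q p e d c b a) = s + ((q + 2 * d + c) - r)" (is ?e1)
    and "phi I1 (tab s r q p e d c b a) = 2 * b + c + p + (r - (q + 2 * d + c))" (is ?f1)
    and "eps I2 (tab s r q p e d c b a) = r + e + (b - (q + d))" (is ?e2)
    and "phi I2 (tab s r q p e d c b a) = a + ((q + d) - b)" (is ?f2)
  using assms by (auto simp: admissible_def tab_def word_simps middle_column middle_column_eqs pw_fold)

text \<open>\<open>[Two, OneBar]\<close> becomes \<open>[One, TwoBar]\<close> in two steps, through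
  \<open>[Two, TwoBar]\<close>. The half-finished column stands to the right of the others of its
  kind and is completed before a new one is begun, which keeps \<open>c \<le> 1\<close>.\<close>

lemma e1_tab:
  assumes "admissible q p e d c"
  shows "e_op I1 (tab s r q p e d c b a) =
    (if r < q + 2 * d + c then
       if 0 < c then Some (tab s r q p e d 0 (Suc b) a)
       else if 0 < d then Some (tab s r q p e (d - 1) 1 b a)
       else Some (tab s r (q - 1) (Suc p) e d c b a)
     else if 0 < s then Some (tab (s - 1) (Suc r) q p e d c b a) else None)"
  using assms by (auto simp: admissible_def tab_def word_simps middle_column middle_column_eqs pw_fold)

lemma f1_tab:
  assumes "admissible q p e d c"
  shows "f_op I1 (tab s r q p e d c b a) =
    (if q + 2 * d + c < r then Some (tab (Suc s) (r - 1) q p e d c b a)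
     else if 0 < p then Some (tab s r (Suc q) (p - 1) e d c b a)
     else if 0 < c then Some (tab s r q p e (Suc d) 0 b a)
     else if 0 < b then Some (tab s r q p e d 1 (b - 1) a) else None)"
  using assms by (auto simp: admissible_def tab_def word_simps middle_column middle_column_eqs pw_fold)

lemma e2_tab:
  assumes "admissible q p e d c"
  shows "e_op I2 (tab s r q p e d c b a) =
    (if q + d < b then Some (tab s r q p e d c (b - 1) (Suc a))
     else if 0 < e then Some (tab s r q p (e - 1) (Suc d) c b a)
     else if 0 < r then Some (tab s (r - 1) (Suc q) p e d c b a) else None)"
  using assms by (auto simp: admissible_def tab_def word_simps middle_column middle_column_eqs pw_fold)

lemma f2_tab:
  assumes "admissible q p e d c"
  shows "f_op I2 (tab s r q p e d c b a) =
    (if b < q + d then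
       if 0 < q then Some (tab s (Suc r) (q - 1) p e d c b a)
       else Some (tab s r q p (Suc e) (d - 1) c b a)
     else if 0 < a then Some (tab s r q p e d c (Suc b) (a - 1)) else None)"
  using assms by (auto simp: admissible_def tab_def word_simps middle_column middle_column_eqs pw_fold)

definition tableaux :: "nat \<Rightarrow> nat \<Rightarrow> word set" where
  "tableaux l1 l2 = {tab s r q p e d c b a | s r q p e d c b a.
     admissible q p e d c \<and> s + r + q + p = l1 \<and> e + d + c + b + a = l2}"

lemma tabI:
  "admissible q p e d c \<Longrightarrow> s + r + q + p = l1 \<Longrightarrow> e + d + c + b + a = l2
    \<Longrightarrow> tab s r q p e d c b a \<in> tableaux l1 l2"
  unfolding tableaux_def by blast

lemma tabE:
  assumes "T \<in> tableaux l1 l2"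
  obtains s r q p e d c b a where "T = tab s r q p e d c b a" "admissible q p e d c"
    "s + r + q + p = l1" "e + d + c + b + a = l2"
  using assms unfolding tableaux_def by blast

lemma highest_word_tab: "highest_word (int l1, int l2) = tab 0 0 0 l1 0 0 0 0 l2"
proof -
  have "replicate n One = pw n [One]" for n
    by (induction n) (auto simp: pw_def)
  then show ?thesis
    by (simp add: highest_word_def tab_def pw_0) (simp add: pw_def)
qed

section \<open>The tableaux form the crystal\<close>

lemma e_op_tableaux:
  assumes "T \<in> tableaux l1 l2" "e_op i T = Some T'"
  shows "T' \<in> tableaux l1 l2"
proof -
  obtain s r q p e d c b a where T: "T = tab s r q p e d c b a" and ad: "admissible q p e d c"
    and l: "s + r + q + p = l1" "e + d + c + b + a = l2"
    using assms(1) by (rule tabE)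
  show ?thesis
    using assms(2) ad l unfolding T
    by (cases i) (auto simp: e1_tab e2_tab admissible_def split: if_splits intro!: tabI)
qed

lemma f_op_tableaux:
  assumes "T \<in> tableaux l1 l2" "f_op i T = Some T'"
  shows "T' \<in> tableaux l1 l2"
proof -
  obtain s r q p e d c b a where T: "T = tab s r q p e d c b a" and ad: "admissible q p e d c"
    and l: "s + r + q + p = l1" "e + d + c + b + a = l2"
    using assms(1) by (rule tabE)
  show ?thesis
    using assms(2) ad l unfolding T
    by (cases i) (auto simp: f1_tab f2_tab admissible_def split: if_splits intro!: tabI)
qed

text \<open>Connectedness: repeated raising ends at the only tableau that neither operator can
  raise.\<close>

lemma tab_induct:
  assumes highest: "tab 0 0 0 l1 0 0 0 0 l2 \<in> X"
    and step: "\<And>i T T'. e_op i T = Some T' \<Longrightarrow> T' \<in> X \<Longrightarrow> T \<in> X"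
    and "admissible q p e d c" "s + r + q + p = l1" "e + d + c + b + a = l2"
  shows "tab s r q p e d c b a \<in> X"
  using assms(3-)
\<comment> \<open>The measure adds up the depths 0, 1, 2, 3 of all letters in the vector crystal, a
  column counting both of its letters. Each raising lowers it by one.\<close>
proof (induction "3 * s + 2 * r + q + 5 * e + 4 * d + 3 * c + 2 * b + a"
    arbitrary: s r q p e d c b a rule: less_induct)
  case less
  let ?T = "tab s r q p e d c b a"
  note ad = less.prems(1)
  show ?case
  proof (cases "\<exists>T'. e_op I1 ?T = Some T'")
    case True
    then obtain T' where T': "e_op I1 ?T = Some T'" ..
    have "T' \<in> X"
      using T' less.prems
      by (auto simp: e1_tab[OF ad] admissible_def split: if_splits intro!: less.hyps)
    then show ?thesis
      using T' by (rule step[rotated])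
  next
    case no1: False
    show ?thesis
    proof (cases "\<exists>T'. e_op I2 ?T = Some T'")
      case True
      then obtain T' where T': "e_op I2 ?T = Some T'" ..
      have "T' \<in> X"
        using T' less.prems
        by (auto simp: e2_tab[OF ad] admissible_def split: if_splits intro!: less.hyps)
      then show ?thesis
        using T' by (rule step[rotated])
    next
      case False
      then have "eps I1 ?T = 0" "eps I2 ?T = 0"
        using no1 e_op_eq_None_iff by (metis option.exhaust)+
      \<comment> \<open>The two equations give s = r = e = 0 first, then q = d = c = 0, and finally
        b = 0.\<close>
      then have "?T = tab 0 0 0 l1 0 0 0 0 l2"
        using less.prems by (simp add: eps_phi_tab)
      then show ?thesis
        using highest by simp
    qed
  qed
qed

lemma crystal_eq_tableaux: "crystal (int l1, int l2) = tableaux l1 l2"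
proof
  show "crystal (int l1, int l2) \<subseteq> tableaux l1 l2"
  proof
    fix T assume "T \<in> crystal (int l1, int l2)"
    then show "T \<in> tableaux l1 l2"
    proof induction
      case crystal_highest
      show ?case
        unfolding highest_word_tab by (rule tabI) (simp_all add: admissible_def)
    qed (auto intro: e_op_tableaux f_op_tableaux)
  qed
  show "tableaux l1 l2 \<subseteq> crystal (int l1, int l2)"
  proof
    fix T assume "T \<in> tableaux l1 l2"
    then obtain s r q p e d c b a where T: "T = tab s r q p e d c b a" "admissible q p e d c"
      "s + r + q + p = l1" "e + d + c + b + a = l2"
      by (rule tabE)
    show "T \<in> crystal (int l1, int l2)"
      unfolding T(1)
    proof (rule tab_induct[OF _ _ T(2-)])
      show "tab 0 0 0 l1 0 0 0 0 l2 \<in> crystal (int l1, int l2)"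
        using crystal_highest[of "(int l1, int l2)"] by (simp add: highest_word_tab)
    qed (metis f_op_iff_e_op crystal_f)
  qed
qed

section \<open>Maximal raising and the string of a tableau\<close>

lemma e_pow_0: "e_pow i 0 T = T"
  and e_pow_Suc: "e_op i T = Some T' \<Longrightarrow> e_pow i (Suc n) T = e_pow i n T'"
  and e_pow_add: "e_pow i (m + n) T = e_pow i m (e_pow i n T)"
  by (simp_all add: e_pow_def funpow_Suc_right funpow_add del: funpow.simps(2))

text \<open>Raising works in three phases: the surplus of \<open>b\<close> over \<open>q + d\<close>
  moves to \<open>a\<close>, then \<open>e\<close> moves to \<open>d\<close>, then \<open>r\<close>
  moves to \<open>q\<close>. Since \<open>q\<close> grows only once \<open>e\<close> is exhausted,
  admissibility persists.\<close>

lemma e2_max: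
  assumes "admissible q p e d c" "n = r + e + (b - (q + d))"
  shows "e_pow I2 n (tab s r q p e d c b a) =
    tab s 0 (q + r) p 0 (d + e) c (min b (q + d)) (a + (b - (q + d)))"
  using assms
proof (induction n arbitrary: r q e d b a)
  case 0
  then show ?case
    by (simp add: e_pow_0)
next
  case (Suc n)
  consider "q + d < b" | "b \<le> q + d" "0 < e" | "b \<le> q + d" "e = 0" "0 < r"
    using Suc.prems(2) by linarith
  then show ?case
  proof cases
    case 1
    have step: "e_op I2 (tab s r q p e d c b a) = Some (tab s r q p e d c (b - 1) (Suc a))"
      using Suc.prems 1 by (simp add: e2_tab)
    have "e_pow I2 n (tab s r q p e d c (b - 1) (Suc a)) =
        tab s 0 (q + r) p 0 (d + e) c (min (b - 1) (q + d)) (Suc a + (b - 1 - (q + d)))"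
      using Suc.prems 1 by (intro Suc.IH) auto
    moreover have "min (b - 1) (q + d) = min b (q + d)" "Suc a + (b - 1 - (q + d)) = a + (b - (q + d))"
      using 1 by auto
    ultimately show ?thesis
      using 1 unfolding e_pow_Suc[OF step] by simp
  next
    case 2
    have step: "e_op I2 (tab s r q p e d c b a) = Some (tab s r q p (e - 1) (Suc d) c b a)"
      using Suc.prems 2 by (simp add: e2_tab)
    have "e_pow I2 n (tab s r q p (e - 1) (Suc d) c b a) =
        tab s 0 (q + r) p 0 (Suc d + (e - 1)) c (min b (q + Suc d)) (a + (b - (q + Suc d)))"
      using Suc.prems 2 by (intro Suc.IH) (auto simp: admissible_def)
    with 2 show ?thesis
      unfolding e_pow_Suc[OF step] by simp
  next
    case 3
    have step: "e_op I2 (tab s r q p e d c b a) = Some (tab s (r - 1) (Suc q) p e d c b a)"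
      using Suc.prems 3 by (simp add: e2_tab)
    have "e_pow I2 n (tab s (r - 1) (Suc q) p e d c b a) =
        tab s 0 (Suc q + (r - 1)) p 0 (d + e) c (min b (Suc q + d)) (a + (b - (Suc q + d)))"
      using Suc.prems 3 by (intro Suc.IH) (auto simp: admissible_def)
    with 3 show ?thesis
      unfolding e_pow_Suc[OF step] by simp
  qed
qed

lemma e1_pow_columns:
  assumes "admissible q p 0 d c" "n = q + 2 * d + c"
  shows "e_pow I1 n (tab s 0 q p 0 d c b a) = tab s 0 0 (p + q) 0 0 0 (b + c + d) a"
  using assms
proof (induction n arbitrary: q p d c b)
  case 0
  then show ?case
    by (simp add: e_pow_0)
next
  case (Suc n)
  consider "c = 1" | "c = 0" "0 < d" | "c = 0" "d = 0" "0 < q"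
    using Suc.prems by (cases "c = 0"; cases "d = 0"; cases "q = 0") (auto simp: admissible_def)
  then show ?case
  proof cases
    case 1
    have step: "e_op I1 (tab s 0 q p 0 d c b a) = Some (tab s 0 q p 0 d 0 (Suc b) a)"
      using Suc.prems 1 by (simp add: e1_tab)
    have "e_pow I1 n (tab s 0 q p 0 d 0 (Suc b) a) = tab s 0 0 (p + q) 0 0 0 (Suc b + 0 + d) a"
      using Suc.prems 1 by (intro Suc.IH) (auto simp: admissible_def)
    with 1 show ?thesis
      unfolding e_pow_Suc[OF step] by simp
  next
    case 2
    have step: "e_op I1 (tab s 0 q p 0 d c b a) = Some (tab s 0 q p 0 (d - 1) 1 b a)"
      using Suc.prems 2 by (simp add: e1_tab)
    have "e_pow I1 n (tab s 0 q p 0 (d - 1) 1 b a) = tab s 0 0 (p + q) 0 0 0 (b + 1 + (d - 1)) a"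
      using Suc.prems 2 by (intro Suc.IH) (auto simp: admissible_def)
    with 2 show ?thesis
      unfolding e_pow_Suc[OF step] by simp
  next
    case 3
    have step: "e_op I1 (tab s 0 q p 0 d c b a) = Some (tab s 0 (q - 1) (Suc p) 0 d c b a)"
      using Suc.prems 3 by (simp add: e1_tab)
    have "e_pow I1 n (tab s 0 (q - 1) (Suc p) 0 d c b a) = tab s 0 0 (Suc p + (q - 1)) 0 0 0 (b + c + d) a"
      using Suc.prems 3 by (intro Suc.IH) (auto simp: admissible_def)
    with 3 show ?thesis
      unfolding e_pow_Suc[OF step] by simp
  qed
qed

lemma e1_pow_OneBar:
  "e_pow I1 s (tab s r 0 p 0 0 0 b a) = tab 0 (r + s) 0 p 0 0 0 b a"
proof (induction s arbitrary: r)
  case (Suc s)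
  have "e_op I1 (tab (Suc s) r 0 p 0 0 0 b a) = Some (tab s (Suc r) 0 p 0 0 0 b a)"
    by (simp add: e1_tab admissible_def)
  then show ?case
    by (simp add: e_pow_Suc Suc.IH)
qed (simp add: e_pow_0)

lemma e1_max:
  assumes "admissible q p 0 d c"
  shows "e_pow I1 (s + (q + 2 * d + c)) (tab s 0 q p 0 d c b a) =
    tab 0 s 0 (p + q) 0 0 0 (b + c + d) a"
  using assms by (simp only: e_pow_add[of I1 s]) (simp add: e1_pow_columns e1_pow_OneBar)

text \<open>After two maximal raisings only \<open>[TwoBar]\<close>, \<open>[One]\<close>,
  \<open>[One, TwoBar]\<close> and \<open>[One, Two]\<close> are left, and the
  \<open>[TwoBar]\<close> are the former \<open>[OneBar]\<close>. The third raising turns them into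
  \<open>[Two]\<close>, so the last coordinate is \<open>s\<close>.\<close>

lemma str2_tab:
  assumes ad: "admissible q p e d c"
  shows "str2 (tab s r q p e d c b a) =
    (r + e + (b - (q + d)), s + (q + r + 2 * (d + e) + c), s + (min b (q + d) + c + d + e), s)"
proof -
  let ?m = "min b (q + d)" and ?a = "a + (b - (q + d))"
  have ad1: "admissible (q + r) p 0 (d + e) c"
    using ad by (auto simp: admissible_def)
  have ad2: "admissible 0 (p + (q + r)) 0 0 0"
    by (simp add: admissible_def)
  show ?thesis
    using e2_max[OF ad refl, of r b s a] e1_max[OF ad1, of s ?m ?a]
      e2_max[OF ad2 refl, of s "?m + c + (d + e)" 0 ?a]
    by (simp add: str2_def Let_def eps_phi_tab[OF ad] eps_phi_tab[OF ad1] eps_phi_tab[OF ad2]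
      eps_phi_tab admissible_def add.assoc)
qed

section \<open>Adapted strings\<close>

text \<open>The chain \<open>d \<le> c \<le> b\<close> is the string cone of type C2. Each of the
  other four inequalities bounds one coordinate by the pairing of its coroot with the highest weight
  minus the later coordinates times their roots.\<close>

definition strings :: "nat \<Rightarrow> nat \<Rightarrow> (nat \<times> nat \<times> nat \<times> nat) set" where
  "strings l1 l2 = {(a, b, c, d). d \<le> c \<and> c \<le> b \<and> d \<le> l1 \<and> c \<le> l2 + d \<and> b + 2 * d \<le> l1 + 2 * c
     \<and> a + 2 * c \<le> l2 + d + b}"

lemma str2_in_strings:
  assumes "T \<in> tableaux l1 l2"
  shows "str2 T \<in> strings l1 l2"
proof -
  obtain s r q p e d c b a where T: "T = tab s r q p e d c b a" and ad: "admissible q p e d c"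
    and l: "s + r + q + p = l1" "e + d + c + b + a = l2"
    using assms by (rule tabE)
  show ?thesis
  proof (cases "b \<le> q + d")
    case True
    then show ?thesis
      using ad unfolding T str2_tab[OF ad] l[symmetric] by (auto simp: strings_def admissible_def min_def)
  next
    case False
    then show ?thesis
      using ad unfolding T str2_tab[OF ad] l[symmetric] by (auto simp: strings_def admissible_def min_def)
  qed
qed

text \<open>
  With \<open>e + d = h\<close>, the number \<open>m\<close> is \<open>min b (q + d)\<close> and \<open>t\<close> is \<open>r + e\<close>; since \<open>q\<close> and
  \<open>e\<close> cannot both be positive, \<open>t\<close> fills \<open>r\<close> first.
\<close>

definition string_tab :: "nat \<Rightarrow> nat \<Rightarrow> nat \<times> nat \<times> nat \<times> nat \<Rightarrow> word" where
  "string_tab l1 l2 x = (case x of (A, B, C, D) \<Rightarrow>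
     if B \<le> l1
     then let r = min A (B - C); b = C - D + (A - r)
          in tab D r (B - D - r) (l1 - B) 0 0 0 b (l2 - b)
     else let c = (B - l1) mod 2; h = (B - l1) div 2; m = C - D - c - h; t = min A (l1 - D + h - m);
              b = m + (A - t); r = min t (l1 - D); e = t - r
          in tab D r (l1 - D - r) 0 e (h - e) c b (l2 - h - c - b))"

text \<open>The second coordinate \<open>B\<close> tells which compatibility condition is active. If
  \<open>B \<le> l1\<close>, then c = d = e = 0 and p is the defect. Otherwise p = 0 and
  \<open>B - l1 = 2 (d + e) + c\<close> with \<open>c \<le> 1\<close>, so parity and half recover
  \<open>c\<close> and \<open>d + e\<close>.\<close>

lemma string_tab_str2:
  assumes "T \<in> tableaux l1 l2"
  shows "string_tab l1 l2 (str2 T) = T"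
proof -
  obtain s r q p e d c b a where T: "T = tab s r q p e d c b a" and ad: "admissible q p e d c"
    and l: "s + r + q + p = l1" "e + d + c + b + a = l2"
    using assms by (rule tabE)
  let ?B = "s + (q + r + 2 * (d + e) + c)"
  show ?thesis
  proof (cases "?B \<le> l1")
    case True
    then have "c = 0 \<and> d = 0 \<and> e = 0"
      using ad l by (auto simp: admissible_def)
    then have *: "p = l1 - (s + (q + r))" "a = l2 - b"
      using l by auto
    have "min (r + (b - q)) (s + (q + r) - (s + min b q)) = r"
      by (cases "b \<le> q") (auto simp: min_def)
    moreover have "min b q + (b - q) = b"
      by (cases "b \<le> q") auto
    ultimately show ?thesis
      using True \<open>c = 0 \<and> d = 0 \<and> e = 0\<close> unfolding T str2_tab[OF ad] string_tab_def
      by (simp add: Let_def *)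
  next
    case False
    then have "p = 0"
      using ad l by (auto simp: admissible_def)
    then have B: "?B - l1 = 2 * (d + e) + c" and L: "l1 - s = r + q"
      using l by auto
    have "c < 2"
      using ad by (auto simp: admissible_def)
    have c: "(?B - l1) mod 2 = c" and h: "(?B - l1) div 2 = d + e"
      unfolding B using \<open>c < 2\<close> by presburger+
    have m: "min b (q + d) + c + d + e - c - (d + e) = min b (q + d)"
      by simp
    have t: "min (r + e + (b - (q + d))) (r + q + (d + e) - min b (q + d)) = r + e"
      by (auto simp: min_def)
    have "0 < q \<Longrightarrow> e = 0"
      using ad by (auto simp: admissible_def)
    then have r: "min (r + e) (r + q) = r"
      by (cases "q = 0") auto
    have b: "min b (q + d) + (b - (q + d)) = b"
      by auto
    have a: "l2 - (d + e) - c - b = a"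
      using l by auto
    show ?thesis
      using False \<open>p = 0\<close> unfolding T str2_tab[OF ad] string_tab_def Let_def
      by (simp only: prod.case if_False c h m t r L b a diff_add_inverse add_diff_cancel_left' diff_add_inverse2)
  qed
qed

lemma string_tab_in_tableaux:
  assumes "x \<in> strings l1 l2"
  shows "string_tab l1 l2 x \<in> tableaux l1 l2 \<and> str2 (string_tab l1 l2 x) = x"
proof -
  obtain A B C D where x: "x = (A, B, C, D)"
    by (cases x) auto
  have S: "D \<le> C" "C \<le> B" "D \<le> l1" "C \<le> l2 + D" "B + 2 * D \<le> l1 + 2 * C" "A + 2 * C \<le> l2 + D + B"
    using assms by (auto simp: strings_def x)
  show ?thesis
  proof (cases "B \<le> l1")
    case True
    define r b where "r = min A (B - C)" and "b = C - D + (A - r)"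
    have eq: "string_tab l1 l2 x = tab D r (B - D - r) (l1 - B) 0 0 0 b (l2 - b)"
      using True by (simp add: string_tab_def x Let_def r_def b_def)
    have ad: "admissible (B - D - r) (l1 - B) 0 0 0"
      by (simp add: admissible_def)
    have r: "r \<le> A" "r + C \<le> B" "r = A \<or> r + C = B"
      using S by (auto simp: r_def)
    have b: "b + D + r = A + C"
      using S r by (simp add: b_def)
    have "tab D r (B - D - r) (l1 - B) 0 0 0 b (l2 - b) \<in> tableaux l1 l2"
      using ad by (rule tabI) (use S True r b in linarith)+
    moreover have "str2 (tab D r (B - D - r) (l1 - B) 0 0 0 b (l2 - b)) = x"
    proof (cases "r = A")
      case True
      then show ?thesis
        unfolding str2_tab[OF ad] x using S r b by auto
    next
      case False
      then show ?thesis
        unfolding str2_tab[OF ad] x using S r b by auto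
    qed
    ultimately show ?thesis
      unfolding eq by simp
  next
    case False
    define c h where "c = (B - l1) mod 2" and "h = (B - l1) div 2"
    have ch: "B = l1 + 2 * h + c" "c \<le> 1"
      using False by (auto simp: c_def h_def)
    define m where "m = C - D - c - h"
    define t where "t = min A (l1 - D + h - m)"
    define b r where "b = m + (A - t)" and "r = min t (l1 - D)"
    define e where "e = t - r"
    have m: "C = D + c + h + m"
      using S ch unfolding m_def by auto
    have mt: "m + t \<le> l1 - D + h" "t \<le> A" "t = A \<or> m + t = l1 - D + h"
      using S ch m unfolding t_def by auto
    have re: "r + e = t" "r = l1 - D \<or> e = 0" "r \<le> l1 - D"
      unfolding e_def r_def by auto
    have eh: "e \<le> h"
      using re mt S ch m by auto
    have eq: "string_tab l1 l2 x = tab D r (l1 - D - r) 0 e (h - e) c b (l2 - h - c - b)"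
      using False by (simp only: string_tab_def x Let_def prod.case if_False c_def h_def m_def t_def b_def r_def e_def)
    have ad: "admissible (l1 - D - r) 0 e (h - e) c"
      using re ch by (auto simp: admissible_def)
    have b: "b + t = m + A"
      using mt by (simp add: b_def)
    have bl: "h + c + b \<le> l2"
      using mt(3)
    proof
      assume "t = A"
      then show ?thesis
        using S ch m b by linarith
    next
      assume "m + t = l1 - D + h"
      then show ?thesis
        using S ch m b mt by linarith
    qed
    have "tab D r (l1 - D - r) 0 e (h - e) c b (l2 - h - c - b) \<in> tableaux l1 l2"
      using ad by (rule tabI) (use re bl eh S in simp_all)
    moreover have "str2 (tab D r (l1 - D - r) 0 e (h - e) c b (l2 - h - c - b)) = x"
    proof -
      have qd: "l1 - D - r + (h - e) = l1 - D + h - t"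
        using re eh by auto
      \<comment> \<open>If \<open>t = A\<close> then \<open>b = m\<close>, which is at most
        \<open>q + d\<close>; otherwise \<open>q + d = m\<close> and the remaining
        \<open>A - t\<close> is the surplus of \<open>b\<close>.\<close>
      have *: "min b (l1 - D - r + (h - e)) = m \<and> t + (b - (l1 - D - r + (h - e))) = A"
        using mt(3)
      proof
        assume "t = A"
        then show ?thesis
          using mt b unfolding qd by auto
      next
        assume "m + t = l1 - D + h"
        then show ?thesis
          using mt b unfolding qd by auto
      qed
      have "D + (l1 - D - r + r + 2 * (h - e + e) + c) = B"
        using re eh ch S by simp
      with * show ?thesis
        unfolding str2_tab[OF ad] x using re eh m by simp
    qed
    ultimately show ?thesis
      unfolding eq by simp
  qed
qed

lemma str2_ex1:
  assumes "x \<in> strings l1 l2"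
  shows "\<exists>!T. T \<in> tableaux l1 l2 \<and> str2 T = x"
  using string_tab_in_tableaux[OF assms] string_tab_str2 by metis

lemma str2_inj:
  "T \<in> tableaux l1 l2 \<Longrightarrow> T' \<in> tableaux l1 l2 \<Longrightarrow> str2 T = str2 T' \<Longrightarrow> T = T'"
  using string_tab_str2 by metis

text \<open>This is the highest weight minus (b + d) \<alpha>_1 and (a + c) \<alpha>_2.\<close>

definition string_wt :: "nat \<Rightarrow> nat \<Rightarrow> nat \<times> nat \<times> nat \<times> nat \<Rightarrow> weight" where
  "string_wt l1 l2 x = (case x of (a, b, c, d) \<Rightarrow>
     (int l1 - 2 * (int b + int d) + 2 * (int a + int c), int l2 + (int b + int d) - 2 * (int a + int c)))"

lemma wt_eq_string_wt:
  assumes "T \<in> tableaux l1 l2"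
  shows "wt T = string_wt l1 l2 (str2 T)"
proof -
  obtain s r q p e d c b a where T: "T = tab s r q p e d c b a" and ad: "admissible q p e d c"
    and l: "s + r + q + p = l1" "e + d + c + b + a = l2"
    using assms by (rule tabE)
  show ?thesis
    using l unfolding T str2_tab[OF ad] wt_tab by (auto simp: string_wt_def min_def)
qed

section \<open>Preatoms and the map in string coordinates\<close>

definition pre_strings :: "nat \<Rightarrow> nat \<Rightarrow> (nat \<times> nat \<times> nat \<times> nat) set" where
  "pre_strings l1 l2 =
     {(a, b, c, d) \<in> strings l1 l2. d = 0 \<or> d = l1 \<or> b + 2 * d = l1 + 2 * c}"

definition pre_tableaux :: "nat \<Rightarrow> nat \<Rightarrow> word set" where
  "pre_tableaux l1 l2 = {T \<in> tableaux l1 l2. str2 T \<in> pre_strings l1 l2}"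

text \<open>Lowering \<open>l1\<close> by 2 and translating by (0,1,1,1) leaves all defining
  inequalities of \<open>strings\<close> unchanged except \<open>0 \<le> d\<close>,
  \<open>d \<le> l1\<close> and \<open>b + 2 d \<le> l1 + 2 c\<close>, which are tightened by one.
  The complement is therefore the union of these three facets.\<close>

lemma preatom_eq: "preatom (int l1, int l2) = pre_tableaux l1 l2"
proof (cases "2 \<le> l1")
  case False
  \<comment> \<open>For \<open>l1 \<le> 1\<close> the bound \<open>d \<le> l1\<close> already puts
    \<open>d\<close> in {0, l1}.\<close>
  then have "strings l1 l2 = pre_strings l1 l2"
    by (auto simp: strings_def pre_strings_def)
  then show ?thesis
    using False str2_in_strings by (auto simp: preatom_def crystal_eq_tableaux pre_tableaux_def)
next
  case True
  define k where "k = l1 - 2"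
  have k: "(int l1, int l2) - varpi1 - varpi1 = (int k, int l2)"
    "(int k, int l2) + varpi1 + varpi1 = (int l1, int l2)" "l1 = k + 2"
    using True by (auto simp: varpi1_def k_def)
  have *: "x + (0, 1, 1, 1) \<in> strings l1 l2" if "x \<in> strings k l2" for x
    using that by (auto simp: strings_def k(3))
  have Phi: "Phi_map (int k, int l2) T \<in> tableaux l1 l2 \<and> str2 (Phi_map (int k, int l2) T) = str2 T + (0, 1, 1, 1)"
    if "T \<in> tableaux k l2" for T
    unfolding Phi_map_def k(2) crystal_eq_tableaux
    by (rule theI'[OF str2_ex1[OF *[OF str2_in_strings[OF that]]]])
  have "T \<in> Phi_map (int k, int l2) ` tableaux k l2 \<longleftrightarrow> str2 T \<notin> pre_strings l1 l2"
    if T: "T \<in> tableaux l1 l2" for T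
  proof
    assume "T \<in> Phi_map (int k, int l2) ` tableaux k l2"
    then obtain U where U: "U \<in> tableaux k l2" "T = Phi_map (int k, int l2) U"
      by blast
    then have "str2 T = str2 U + (0, 1, 1, 1)"
      using Phi by blast
    then show "str2 T \<notin> pre_strings l1 l2"
      using str2_in_strings[OF U(1)] by (auto simp: strings_def pre_strings_def k(3))
  next
    assume not: "str2 T \<notin> pre_strings l1 l2"
    obtain a b c d where x: "str2 T = (a, b, c, d)"
      by (cases "str2 T") auto
    have S: "(a, b - 1, c - 1, d - 1) \<in> strings k l2" "1 \<le> b" "1 \<le> c" "1 \<le> d"
      using str2_in_strings[OF T] not by (auto simp: x strings_def pre_strings_def k(3))
    obtain U where U: "U \<in> tableaux k l2" "str2 U = (a, b - 1, c - 1, d - 1)"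
      using str2_ex1[OF S(1)] by blast
    have "T = Phi_map (int k, int l2) U"
      using Phi[OF U(1)] U(2) S T by (intro str2_inj[of T l1 l2]) (auto simp: x)
    then show "T \<in> Phi_map (int k, int l2) ` tableaux k l2"
      using U(1) by blast
  qed
  then show ?thesis
    using True unfolding preatom_def k(1) crystal_eq_tableaux pre_tableaux_def by auto
qed

definition psi :: "nat \<Rightarrow> nat \<times> nat \<times> nat \<times> nat \<Rightarrow> nat \<times> nat \<times> nat \<times> nat" where
  "psi l1 x = (case x of (a, b, c, d) \<Rightarrow>
     if d = 0 \<or> d = l1 then (a, b + 1, c + 1, d) else (a, b, c + 1, d + 1))"

lemma psi_pre_strings: "x \<in> pre_strings l1 l2 \<Longrightarrow> psi l1 x \<in> pre_strings l1 (Suc l2)"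
  by (auto simp: pre_strings_def strings_def psi_def split: if_splits)

text \<open>The branches could only collide at fourth coordinate \<open>l1\<close>, between (a, b,
  c, l1 - 1) and (a, b - 1, c, l1). The first lies on the facet \<open>b + 2 d = l1 + 2 c\<close>,
  so the second would exceed it by one.\<close>

lemma psi_inj: "inj_on (psi l1) (pre_strings l1 l2)"
  by (rule inj_onI) (auto simp: pre_strings_def strings_def psi_def split: if_splits)

text \<open>Both branches add one to \<open>b + d\<close> and one to \<open>a + c\<close>, and
  \<varpi>_2 = \<alpha>_1 + \<alpha>_2.\<close>

lemma string_wt_psi: "string_wt l1 (Suc l2) (psi l1 x) = string_wt l1 l2 x"
  by (auto simp: string_wt_def psi_def split: prod.splits)

lemma varpi2_add: "(int l1, int l2) + varpi2 = (int l1, int (Suc l2))"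
  by (simp add: varpi2_def)

lemma Psi_map_string:
  assumes "T \<in> pre_tableaux l1 l2"
  shows "Psi_map (int l1, int l2) T \<in> pre_tableaux l1 (Suc l2)"
    and "str2 (Psi_map (int l1, int l2) T) = psi l1 (str2 T)"
proof -
  have T: "T \<in> tableaux l1 l2" "str2 T \<in> pre_strings l1 l2"
    using assms by (auto simp: pre_tableaux_def)
  have eq: "Psi_string (int l1, int l2) (str2 T) = psi l1 (str2 T)"
    by (auto simp: Psi_string_def psi_def split: prod.splits)
  have "psi l1 (str2 T) \<in> pre_strings l1 (Suc l2)"
    using T by (simp add: psi_pre_strings)
  moreover from this have "psi l1 (str2 T) \<in> strings l1 (Suc l2)"
    by (auto simp: pre_strings_def)
  ultimately have "\<exists>!T'. T' \<in> pre_tableaux l1 (Suc l2) \<and> str2 T' = psi l1 (str2 T)"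
    using str2_ex1[of "psi l1 (str2 T)" l1 "Suc l2"] by (auto simp: pre_tableaux_def)
  from theI'[OF this] show "Psi_map (int l1, int l2) T \<in> pre_tableaux l1 (Suc l2)"
    "str2 (Psi_map (int l1, int l2) T) = psi l1 (str2 T)"
    unfolding Psi_map_def varpi2_add preatom_eq eq by simp_all
qed

lemma wt_Psi_map:
  assumes "T \<in> pre_tableaux l1 l2"
  shows "wt (Psi_map (int l1, int l2) T) = wt T"
proof -
  have "T \<in> tableaux l1 l2" "Psi_map (int l1, int l2) T \<in> tableaux l1 (Suc l2)"
    using assms Psi_map_string(1)[OF assms] by (auto simp: pre_tableaux_def)
  then show ?thesis
    by (simp add: wt_eq_string_wt Psi_map_string(2)[OF assms] string_wt_psi)
qed

lemma inj_on_Psi_map: "inj_on (Psi_map (int l1, int l2)) (pre_tableaux l1 l2)"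
proof (rule inj_onI)
  fix T U assume T: "T \<in> pre_tableaux l1 l2" and U: "U \<in> pre_tableaux l1 l2"
    and "Psi_map (int l1, int l2) T = Psi_map (int l1, int l2) U"
  then have "psi l1 (str2 T) = psi l1 (str2 U)"
    using Psi_map_string(2) by metis
  then have "str2 T = str2 U"
    by (rule inj_onD[OF psi_inj[of l1 l2]]) (use T U in \<open>auto simp: pre_tableaux_def\<close>)
  then show "T = U"
    using T U str2_inj by (auto simp: pre_tableaux_def)
qed

lemma bij_betw_str2: "bij_betw str2 (pre_tableaux l1 l2) (pre_strings l1 l2)"
proof (rule bij_betw_imageI)
  show "inj_on str2 (pre_tableaux l1 l2)"
    by (rule inj_onI) (auto simp: pre_tableaux_def intro: str2_inj)
  show "str2 ` pre_tableaux l1 l2 = pre_strings l1 l2"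
  proof
    show "pre_strings l1 l2 \<subseteq> str2 ` pre_tableaux l1 l2"
    proof
      fix x assume x: "x \<in> pre_strings l1 l2"
      then have "x \<in> strings l1 l2"
        by (auto simp: pre_strings_def)
      then show "x \<in> str2 ` pre_tableaux l1 l2"
        using x str2_ex1[of x l1 l2] by (auto simp: pre_tableaux_def)
    qed
  qed (auto simp: pre_tableaux_def)
qed

lemma Psi_map_image: "str2 ` Psi_map (int l1, int l2) ` A = psi l1 ` str2 ` A" if "A \<subseteq> pre_tableaux l1 l2"
  using that by (force simp: image_image Psi_map_string(2) subset_iff intro!: image_cong)

section \<open>Reversal of 1-strings\<close>

lemma f_pow_0: "f_pow i 0 T = T"
  and f_pow_Suc: "f_op i T = Some T' \<Longrightarrow> f_pow i (Suc n) T = f_pow i n T'"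
  by (simp_all add: f_pow_def funpow_Suc_right del: funpow.simps(2))

text \<open>An arbitrary set \<open>X\<close> closed under the operator is carried along, so that
  string reversal can later be confined to the invariant sets \<open>core_tableaux\<close>.\<close>

lemma f_pow_string:
  assumes "n \<le> phi i T"
    and "T \<in> X" "\<And>U U'. U \<in> X \<Longrightarrow> f_op i U = Some U' \<Longrightarrow> U' \<in> X"
  shows "f_pow i n T \<in> X \<and> eps i (f_pow i n T) = eps i T + n \<and> phi i T = phi i (f_pow i n T) + n
    \<and> e_pow i n (f_pow i n T) = T
    \<and> wt (f_pow i n T) = wt T - (int n * fst (simple_root i), int n * snd (simple_root i))"
  using assms(1,2)
proof (induction n arbitrary: T)
  case 0
  then show ?case
    by (simp add: f_pow_0 e_pow_0 zero_prod_def[symmetric])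
next
  case (Suc n)
  then obtain T' where T': "f_op i T = Some T'"
    using f_op_eq_None_iff[of i T] by (cases "f_op i T") auto
  note T'_props = f_op_eps_phi[OF T']
  have IH: "f_pow i n T' \<in> X \<and> eps i (f_pow i n T') = eps i T' + n \<and> phi i T' = phi i (f_pow i n T') + n
    \<and> e_pow i n (f_pow i n T') = T'
    \<and> wt (f_pow i n T') = wt T' - (int n * fst (simple_root i), int n * snd (simple_root i))"
    using Suc.prems T'_props assms(3)[OF _ T'] by (intro Suc.IH) auto
  have "e_pow i (Suc n) (f_pow i n T') = e_pow i 1 (e_pow i n (f_pow i n T'))"
    using e_pow_add[of i 1 n] by simp
  also have "\<dots> = T"
    using IH T'_props by (simp add: e_pow_def)
  finally show ?case
    unfolding f_pow_Suc[OF T'] using IH T'_props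
    by (auto simp: prod_eq_iff algebra_simps)
qed

lemma e_pow_string:
  assumes "n \<le> eps i T"
    and "T \<in> X" "\<And>U U'. U \<in> X \<Longrightarrow> e_op i U = Some U' \<Longrightarrow> U' \<in> X"
  shows "e_pow i n T \<in> X \<and> eps i T = eps i (e_pow i n T) + n \<and> phi i (e_pow i n T) = phi i T + n
    \<and> f_pow i n (e_pow i n T) = T
    \<and> wt (e_pow i n T) = wt T + (int n * fst (simple_root i), int n * snd (simple_root i))"
  using assms(1,2)
proof (induction n arbitrary: T)
  case 0
  then show ?case
    by (simp add: f_pow_0 e_pow_0 zero_prod_def[symmetric])
next
  case (Suc n)
  then obtain T' where T': "e_op i T = Some T'"
    using e_op_eq_None_iff[of i T] by (cases "e_op i T") auto
  note T'_props = f_op_eps_phi[OF T'[folded f_op_iff_e_op]]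
  have IH: "e_pow i n T' \<in> X \<and> eps i T' = eps i (e_pow i n T') + n \<and> phi i (e_pow i n T') = phi i T' + n
    \<and> f_pow i n (e_pow i n T') = T'
    \<and> wt (e_pow i n T') = wt T' + (int n * fst (simple_root i), int n * snd (simple_root i))"
    using Suc.prems T'_props assms(3)[OF _ T'] by (intro Suc.IH) auto
  have "f_pow i (Suc n) (e_pow i n T') = f_pow i 1 (f_pow i n (e_pow i n T'))"
    by (simp add: f_pow_def)
  also have "\<dots> = T"
    using IH T'[folded f_op_iff_e_op] by (simp add: f_pow_def)
  finally show ?case
    unfolding e_pow_Suc[OF T'] using IH T'_props
    by (auto simp: prod_eq_iff algebra_simps)
qed

lemma s1_crystal_props:
  assumes "T \<in> X"
    and "\<And>U U'. U \<in> X \<Longrightarrow> f_op I1 U = Some U' \<Longrightarrow> U' \<in> X"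
    and "\<And>U U'. U \<in> X \<Longrightarrow> e_op I1 U = Some U' \<Longrightarrow> U' \<in> X"
  shows "s1_crystal T \<in> X" "eps I1 (s1_crystal T) = phi I1 T" "phi I1 (s1_crystal T) = eps I1 T"
    "s1_crystal (s1_crystal T) = T" "wt (s1_crystal T) = refl I1 (wt T)"
proof -
  have "s1_crystal T \<in> X \<and> eps I1 (s1_crystal T) = phi I1 T \<and> phi I1 (s1_crystal T) = eps I1 T \<and>
    s1_crystal (s1_crystal T) = T \<and> wt (s1_crystal T) = refl I1 (wt T)"
  proof (cases "eps I1 T \<le> phi I1 T")
    case True
    define n where "n = phi I1 T - eps I1 T"
    have n: "fst (wt T) = int n" "n \<le> phi I1 T"
      using phi_minus_eps[of T] True by (auto simp: n_def)
    define U where "U = f_pow I1 n T"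
    have U: "U \<in> X" "eps I1 U = eps I1 T + n" "phi I1 T = phi I1 U + n" "e_pow I1 n U = T"
      "wt U = wt T - (int n * fst (simple_root I1), int n * snd (simple_root I1))"
      unfolding U_def using f_pow_string[where X = X, OF n(2) assms(1)] assms(2) by blast+
    have "s1_crystal T = U"
      using True by (simp add: s1_crystal_def U_def n_def)
    moreover have "phi I1 U = eps I1 T"
      using True U(3) n_def by linarith
    moreover have "wt U = refl I1 (wt T)"
      using n(1) by (cases "wt T") (simp add: U(5))
    moreover have "s1_crystal U = T"
      \<comment> \<open>For n > 0 the second reversal takes the raising branch; for n = 0 the test
        holds with equality and it lowers zero times.\<close>
      using U(2,4) calculation(2) by (cases "n = 0") (auto simp: s1_crystal_def e_pow_0 f_pow_0)
    ultimately show ?thesis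
      using U(1-3) by simp
  next
    case False
    define n where "n = eps I1 T - phi I1 T"
    have n: "fst (wt T) = - int n" "n \<le> eps I1 T"
      using phi_minus_eps[of T] False by (auto simp: n_def)
    define U where "U = e_pow I1 n T"
    have U: "U \<in> X" "eps I1 T = eps I1 U + n" "phi I1 U = phi I1 T + n" "f_pow I1 n U = T"
      "wt U = wt T + (int n * fst (simple_root I1), int n * snd (simple_root I1))"
      unfolding U_def using e_pow_string[where X = X, OF n(2) assms(1)] assms(3) by blast+
    have "s1_crystal T = U"
      using False by (simp add: s1_crystal_def U_def n_def)
    moreover have "eps I1 U = phi I1 T"
      using False U(2) n_def by linarith
    moreover have "wt U = refl I1 (wt T)"
      using n(1) by (cases "wt T") (simp add: U(5))
    moreover have "s1_crystal U = T"
      using U(3,4) calculation(2) by (simp add: s1_crystal_def)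
    ultimately show ?thesis
      using U(1-3) by simp
  qed
  then show "s1_crystal T \<in> X" "eps I1 (s1_crystal T) = phi I1 T" "phi I1 (s1_crystal T) = eps I1 T"
    "s1_crystal (s1_crystal T) = T" "wt (s1_crystal T) = refl I1 (wt T)"
    by auto
qed

section \<open>Stability of the preatom under string reversal\<close>

definition core_tableaux :: "nat \<Rightarrow> nat \<Rightarrow> nat \<Rightarrow> word set" where
  "core_tableaux l1 l2 k = {tab s r q p e d c b a | s r q p e d c b a.
     admissible q p e d c \<and> s + r + q + p = l1 \<and> e + d + c + b + a = l2 \<and> s + (r - (q + 2 * d + c)) = k}"

lemma coreI:
  "admissible q p e d c \<Longrightarrow> s + r + q + p = l1 \<Longrightarrow> e + d + c + b + a = l2 \<Longrightarrow>
    s + (r - (q + 2 * d + c)) = k \<Longrightarrow> tab s r q p e d c b a \<in> core_tableaux l1 l2 k"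
  unfolding core_tableaux_def by blast

lemma coreE:
  assumes "T \<in> core_tableaux l1 l2 k"
  obtains s r q p e d c b a where "T = tab s r q p e d c b a" "admissible q p e d c"
    "s + r + q + p = l1" "e + d + c + b + a = l2" "s + (r - (q + 2 * d + c)) = k"
  using assms unfolding core_tableaux_def by blast

text \<open>While \<open>r < q + 2 d + c\<close>, the truncated difference stays 0 and
  \<open>s\<close> is untouched; afterwards each step trades a \<open>[OneBar]\<close> for a
  \<open>[TwoBar]\<close>. Either way the number of \<open>[OneBar]\<close> and uncancelled
  \<open>[TwoBar]\<close> is unchanged.\<close>

lemma core_tableaux_e_op:
  assumes "T \<in> core_tableaux l1 l2 k" "e_op I1 T = Some T'"
  shows "T' \<in> core_tableaux l1 l2 k"
proof -
  obtain s r q p e d c b a where T: "T = tab s r q p e d c b a" and ad: "admissible q p e d c"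
    and l: "s + r + q + p = l1" "e + d + c + b + a = l2" "s + (r - (q + 2 * d + c)) = k"
    using assms(1) by (rule coreE)
  show ?thesis
    using assms(2) ad l unfolding T
    by (auto simp: e1_tab admissible_def split: if_splits intro!: coreI)
qed

lemma core_tableaux_f_op:
  assumes "T \<in> core_tableaux l1 l2 k" "f_op I1 T = Some T'"
  shows "T' \<in> core_tableaux l1 l2 k"
proof -
  obtain s r q p e d c b a where T: "T = tab s r q p e d c b a" and ad: "admissible q p e d c"
    and l: "s + r + q + p = l1" "e + d + c + b + a = l2" "s + (r - (q + 2 * d + c)) = k"
    using assms(1) by (rule coreE)
  show ?thesis
    using assms(2) ad l unfolding T
    by (auto simp: f1_tab admissible_def split: if_splits intro!: coreI)
qed

text \<open>The fourth string coordinate is \<open>s\<close>, which gives the first two facets; the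
  slack in the inequality of the third is \<open>p + 2 min b (q + d) + c\<close>.\<close>

lemma tab_in_pre_tableaux_iff:
  assumes ad: "admissible q p e d c" and l: "s + r + q + p = l1" "e + d + c + b + a = l2"
  shows "tab s r q p e d c b a \<in> pre_tableaux l1 l2 \<longleftrightarrow>
    s = 0 \<or> s = l1 \<or> p = 0 \<and> c = 0 \<and> (b = 0 \<or> q + d = 0)"
proof -
  have T: "tab s r q p e d c b a \<in> tableaux l1 l2"
    using assms by (rule tabI)
  have "s + (q + r + 2 * (d + e) + c) + 2 * s = l1 + 2 * (s + (min b (q + d) + c + d + e)) \<longleftrightarrow>
     p + 2 * min b (q + d) + c = 0"
    using l by auto
  also have "\<dots> \<longleftrightarrow> p = 0 \<and> c = 0 \<and> (b = 0 \<or> q + d = 0)"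
    by (auto simp: min_def)
  finally show ?thesis
    using T str2_in_strings[OF T] unfolding pre_tableaux_def pre_strings_def mem_Collect_eq str2_tab[OF ad]
    by auto
qed

text \<open>
  The number \<open>k\<close> is constant on the \<open>1\<close>-string, and membership in the preatom depends only on
  \<open>k\<close> and, symmetrically, on the position in the string.
\<close>

lemma core_in_pre_tableaux_iff:
  assumes "T \<in> core_tableaux l1 l2 k"
  shows "T \<in> pre_tableaux l1 l2 \<longleftrightarrow>
    \<not> (0 < eps I1 T \<and> 0 < phi I1 T \<and> 0 < k \<and> k < l1 \<and> k < eps I1 T + phi I1 T)"
proof -
  obtain s r q p e d c b a where T: "T = tab s r q p e d c b a" and ad: "admissible q p e d c"
    and l: "s + r + q + p = l1" "e + d + c + b + a = l2" "s + (r - (q + 2 * d + c)) = k"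
    using assms by (rule coreE)
  show ?thesis
    unfolding T tab_in_pre_tableaux_iff[OF ad l(1,2)] eps_phi_tab[OF ad]
    using l(3,1) by (cases "s = 0"; cases "s = l1"; cases "q + 2 * d + c < r"; cases "b = 0"; cases "q + d = 0") auto
qed

lemma s1_crystal_pre_tableaux:
  assumes "T \<in> pre_tableaux l1 l2"
  shows "s1_crystal T \<in> pre_tableaux l1 l2" "s1_crystal (s1_crystal T) = T"
    "wt (s1_crystal T) = refl I1 (wt T)"
proof -
  have "T \<in> tableaux l1 l2"
    using assms by (simp add: pre_tableaux_def)
  then obtain k where k: "T \<in> core_tableaux l1 l2 k"
    by (auto elim!: tabE intro: coreI)
  note s1 = s1_crystal_props[OF k core_tableaux_f_op core_tableaux_e_op]
  show "s1_crystal (s1_crystal T) = T" "wt (s1_crystal T) = refl I1 (wt T)"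
    by (simp_all add: s1)
  show "s1_crystal T \<in> pre_tableaux l1 l2"
    \<comment> \<open>Reversal exchanges \<open>eps I1\<close> and \<open>phi I1\<close> and keeps
      \<open>k\<close>, and the criterion is symmetric in the two.\<close>
    using assms by (auto simp: core_in_pre_tableaux_iff[OF s1(1)] core_in_pre_tableaux_iff[OF k] s1)
qed

section \<open>The octagon\<close>

lemma convex_horizontal:
  fixes C :: "(real \<times> real) set"
  assumes "convex C" "(a, y) \<in> C" "(b, y) \<in> C" "x \<in> closed_segment a b"
  shows "(x, y) \<in> C"
proof -
  obtain t where t: "x = (1 - t) * a + t * b" "0 \<le> t" "t \<le> 1"
    using assms(4) by (auto simp: in_segment)
  have "(1 - t) *\<^sub>R (a, y) + t *\<^sub>R (b, y) \<in> C"
    using assms(1-3) t(2,3) by (intro convexD_alt) auto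
  moreover have "(1 - t) *\<^sub>R (a, y) + t *\<^sub>R (b, y) = (x, y)"
    by (simp add: t(1) algebra_simps)
  ultimately show ?thesis
    by simp
qed

lemma convex_vertical:
  fixes C :: "(real \<times> real) set"
  assumes "convex C" "(x, a) \<in> C" "(x, b) \<in> C" "y \<in> closed_segment a b"
  shows "(x, y) \<in> C"
proof -
  obtain t where t: "y = (1 - t) * a + t * b" "0 \<le> t" "t \<le> 1"
    using assms(4) by (auto simp: in_segment)
  have "(1 - t) *\<^sub>R (x, a) + t *\<^sub>R (x, b) \<in> C"
    using assms(1-3) t(2,3) by (intro convexD_alt) auto
  moreover have "(1 - t) *\<^sub>R (x, a) + t *\<^sub>R (x, b) = (x, y)"
    by (simp add: t(1) algebra_simps)
  ultimately show ?thesis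
    by simp
qed

lemma convex_rectangle:
  fixes C :: "(real \<times> real) set"
  assumes "convex C" and "\<And>\<sigma> \<tau>. \<bar>\<sigma>\<bar> = 1 \<Longrightarrow> \<bar>\<tau>\<bar> = 1 \<Longrightarrow> (\<sigma> * U, \<tau> * V) \<in> C"
    and "\<bar>x\<bar> \<le> U" "\<bar>y\<bar> \<le> V"
  shows "(x, y) \<in> C"
proof (rule convex_vertical[OF assms(1)])
  have x: "x \<in> closed_segment (- U) U"
    using assms(3) by (auto simp: closed_segment_eq_real_ivl)
  show "(x, V) \<in> C"
    using assms(2)[of 1 1] assms(2)[of "- 1" 1] by (auto intro: convex_horizontal[OF assms(1) _ _ x])
  show "(x, - V) \<in> C"
    using assms(2)[of 1 "- 1"] assms(2)[of "- 1" "- 1"] by (auto intro: convex_horizontal[OF assms(1) _ _ x])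
  show "y \<in> closed_segment V (- V)"
    using assms(4) by (auto simp: closed_segment_eq_real_ivl)
qed

text \<open>Two crossing rectangles cover everything except the four corners with |u|, |v| > V. A
  corner point lies on a vertical segment from a rectangle to the slanted edge between two
  vertices.\<close>

lemma convex_octagon:
  fixes C :: "(real \<times> real) set"
  assumes C: "convex C"
    and UV: "\<And>\<sigma> \<tau>. \<bar>\<sigma>\<bar> = 1 \<Longrightarrow> \<bar>\<tau>\<bar> = 1 \<Longrightarrow> (\<sigma> * U, \<tau> * V) \<in> C"
    and VU: "\<And>\<sigma> \<tau>. \<bar>\<sigma>\<bar> = 1 \<Longrightarrow> \<bar>\<tau>\<bar> = 1 \<Longrightarrow> (\<sigma> * V, \<tau> * U) \<in> C"
    and "0 \<le> V" "\<bar>u\<bar> \<le> U" "\<bar>v\<bar> \<le> U" "\<bar>u\<bar> + \<bar>v\<bar> \<le> U + V"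
  shows "(u, v) \<in> C"
proof -
  consider "\<bar>v\<bar> \<le> V" | "\<bar>u\<bar> \<le> V" | "V < \<bar>u\<bar>" "V < \<bar>v\<bar>"
    by linarith
  then show ?thesis
  proof cases
    case 1
    show ?thesis
      by (rule convex_rectangle[OF C]) (rule UV, assumption, assumption, fact \<open>\<bar>u\<bar> \<le> U\<close>, fact 1)
  next
    case 2
    show ?thesis
      by (rule convex_rectangle[OF C]) (rule VU, assumption, assumption, fact 2, fact \<open>\<bar>v\<bar> \<le> U\<close>)
  next
    case 3
    define \<sigma> \<tau> where "\<sigma> = sgn u" and "\<tau> = sgn v"
    have sgn: "\<bar>\<sigma>\<bar> = 1" "\<bar>\<tau>\<bar> = 1" "u = \<sigma> * \<bar>u\<bar>" "v = \<tau> * \<bar>v\<bar>"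
      using 3 \<open>0 \<le> V\<close> by (auto simp: \<sigma>_def \<tau>_def sgn_if)
    \<comment> \<open>The parameter at which the slanted edge has first coordinate \<open>u\<close>;
      \<open>U > V\<close> because \<open>V < \<bar>u\<bar> \<le> U\<close>.\<close>
    define t where "t = (\<bar>u\<bar> - V) / (U - V)"
    have t: "0 \<le> t" "t \<le> 1" "t * (U - V) = \<bar>u\<bar> - V"
      using 3 assms by (auto simp: t_def field_simps)
    have "(1 - t) *\<^sub>R (\<sigma> * V, \<tau> * U) + t *\<^sub>R (\<sigma> * U, \<tau> * V) \<in> C"
      using UV[OF sgn(1,2)] VU[OF sgn(1,2)] t(1,2) C by (intro convexD_alt) auto
    moreover have "(1 - t) * (\<sigma> * V) + t * (\<sigma> * U) = \<sigma> * (V + t * (U - V))"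
      "(1 - t) * (\<tau> * U) + t * (\<tau> * V) = \<tau> * (U - t * (U - V))"
      by (simp_all add: algebra_simps)
    moreover have "U - t * (U - V) = U + V - \<bar>u\<bar>" "V + t * (U - V) = \<bar>u\<bar>"
      by (simp_all add: t(3))
    ultimately have top: "(u, \<tau> * (U + V - \<bar>u\<bar>)) \<in> C"
      using sgn(3) by simp
    have bottom: "(u, \<tau> * V) \<in> C"
    proof (rule convex_rectangle[OF C])
      show "\<bar>\<tau> * V\<bar> \<le> V"
        using sgn(2) \<open>0 \<le> V\<close> by (simp add: abs_mult)
    qed (rule UV, assumption, assumption, fact \<open>\<bar>u\<bar> \<le> U\<close>)
    have v: "V \<le> \<bar>v\<bar>" "\<bar>v\<bar> \<le> U + V - \<bar>u\<bar>"
      using 3 assms by linarith+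
    have "v \<in> closed_segment (\<tau> * V) (\<tau> * (U + V - \<bar>u\<bar>))"
    proof (cases "0 \<le> v")
      case True
      then have "\<tau> = 1"
        using 3 \<open>0 \<le> V\<close> by (simp add: \<tau>_def sgn_if)
      then show ?thesis
        using v True by (simp add: closed_segment_eq_real_ivl)
    next
      case False
      then have "\<tau> = - 1"
        by (simp add: \<tau>_def sgn_if)
      then show ?thesis
        using v False by (simp add: closed_segment_eq_real_ivl)
    qed
    then show ?thesis
      using convex_vertical[OF C bottom top] by blast
  qed
qed

section \<open>The Weyl orbit and the order on weights\<close>

lemma weyl_orbit_self: "\<nu> \<in> weyl_orbit \<nu>"
  unfolding weyl_orbit_def by (rule image_eqI[OF _ weyl_group.weyl_id]) simp

lemma weyl_orbit_refl: "\<mu> \<in> weyl_orbit \<nu> \<Longrightarrow> refl i \<mu> \<in> weyl_orbit \<nu>"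
  unfolding weyl_orbit_def by (auto simp: image_iff) (metis comp_apply weyl_group.weyl_refl)

text \<open>In the coordinates \<open>(u, v) = (\<mu>\<^sub>1 + \<mu>\<^sub>2, \<mu>\<^sub>2)\<close> the group \<open>W\<close> acts by signed permutations.\<close>

lemma weyl_orbit_vertices:
  assumes "\<bar>\<sigma>\<bar> = 1" "\<bar>\<tau>\<bar> = 1"
  shows "(\<sigma> * (n1 + n2) - \<tau> * n2, \<tau> * n2) \<in> weyl_orbit (n1, n2)"
    and "(\<sigma> * n2 - \<tau> * (n1 + n2), \<tau> * (n1 + n2)) \<in> weyl_orbit (n1, n2)"
proof -
  have swap: "(v - u, u) \<in> weyl_orbit (n1, n2)" if "(u - v, v) \<in> weyl_orbit (n1, n2)" for u v
    using weyl_orbit_refl[OF that, of I1] by simp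
  have neg: "(u + v, - v) \<in> weyl_orbit (n1, n2)" if "(u - v, v) \<in> weyl_orbit (n1, n2)" for u v
    using weyl_orbit_refl[OF that, of I2] by (simp add: add.commute)
  have neg\<tau>: "(u - \<tau> * v, \<tau> * v) \<in> weyl_orbit (n1, n2)" if "(u - v, v) \<in> weyl_orbit (n1, n2)" "\<bar>\<tau>\<bar> = 1" for u v \<tau>
    using neg[OF that(1)] that by (cases "\<tau> = 1") (auto simp: abs_if split: if_splits)
  have "(n1 + n2 - n2, n2) \<in> weyl_orbit (n1, n2)"
    using weyl_orbit_self by simp
  from neg\<tau>[OF this assms(2)] have A: "(n1 + n2 - \<tau> * n2, \<tau> * n2) \<in> weyl_orbit (n1, n2)" .
  from neg\<tau>[OF swap[OF this] assms(1)] have B: "(\<tau> * n2 - \<sigma> * (n1 + n2), \<sigma> * (n1 + n2)) \<in> weyl_orbit (n1, n2)" .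
  from swap[OF this] show "(\<sigma> * (n1 + n2) - \<tau> * n2, \<tau> * n2) \<in> weyl_orbit (n1, n2)" .
  have "(n1 + n2 - n2, n2) \<in> weyl_orbit (n1, n2)"
    using weyl_orbit_self by simp
  from swap[OF neg\<tau>[OF this assms(1)]] have "(\<sigma> * n2 - (n1 + n2), n1 + n2) \<in> weyl_orbit (n1, n2)" .
  from neg\<tau>[OF this assms(2)] show "(\<sigma> * n2 - \<tau> * (n1 + n2), \<tau> * (n1 + n2)) \<in> weyl_orbit (n1, n2)" .
qed

lemma weyl_orbit_bounds:
  assumes "0 \<le> n1" "0 \<le> n2" "(m1, m2) \<in> weyl_orbit (n1, n2)"
  shows "\<bar>m1 + m2\<bar> \<le> n1 + n2 \<and> \<bar>m2\<bar> \<le> n1 + n2 \<and> \<bar>m1 + m2\<bar> + \<bar>m2\<bar> \<le> n1 + 2 * n2"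
proof -
  obtain w where w: "w \<in> weyl_group" "w (n1, n2) = (m1, m2)"
    using assms(3) by (auto simp: weyl_orbit_def)
  then show ?thesis
  proof (induction arbitrary: m1 m2)
    case weyl_id
    then show ?case
      using assms(1,2) by simp
  next
    case (weyl_refl w i)
    obtain k1 k2 where k: "w (n1, n2) = (k1, k2)"
      by (cases "w (n1, n2)") auto
    from weyl_refl.IH[OF this] weyl_refl.prems k show ?case
      by (cases i) auto
  qed
qed

lemma root_lattice_iff: "(k1, k2) \<in> root_lattice \<longleftrightarrow> even k1"
proof
  assume "even k1"
  then obtain j where "k1 = 2 * j" ..
  \<comment> \<open>The coefficients solve k1 = 2 m - 2 n and k2 = - m + 2 n.\<close>
  then have "(k1, k2) = ((k1 + k2) * fst (simple_root I1) + (j + k2) * fst (simple_root I2),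
      (k1 + k2) * snd (simple_root I1) + (j + k2) * snd (simple_root I2))"
    by simp
  then show "(k1, k2) \<in> root_lattice"
    unfolding root_lattice_def by blast
qed (auto simp: root_lattice_def)

lemma convex_halfplane: "convex {p :: real \<times> real. a * fst p + b * snd p \<le> c}"
  using convex_halfspace_le[of "(a, b)" c] by (simp add: inner_prod_def)

text \<open>The orbit, hence its hull, lies in an intersection of eight half-planes. Conversely,
  \<open>convex_octagon\<close> applies to the preimage of the hull under the change of coordinates,
  with U = n1 + n2 and V = n2.\<close>

lemma weight_le_iff:
  assumes n: "0 \<le> n1" "0 \<le> n2"
  shows "weight_le (m1, m2) (n1, n2) \<longleftrightarrow>
    \<bar>m1 + m2\<bar> \<le> n1 + n2 \<and> \<bar>m2\<bar> \<le> n1 + n2 \<and> \<bar>m1 + m2\<bar> + \<bar>m2\<bar> \<le> n1 + 2 * n2 \<and> even (m1 - n1)"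
proof -
  let ?H = "convex hull (real_weight ` weyl_orbit (n1, n2))"
  let ?A = "real_of_int (n1 + n2)" and ?B = "real_of_int (n1 + 2 * n2)"
  define K where "K = {p :: real \<times> real. 1 * fst p + 1 * snd p \<le> ?A} \<inter> {p. (-1) * fst p + (-1) * snd p \<le> ?A}
    \<inter> {p. 0 * fst p + 1 * snd p \<le> ?A} \<inter> {p. 0 * fst p + (-1) * snd p \<le> ?A}
    \<inter> {p. 1 * fst p + 2 * snd p \<le> ?B} \<inter> {p. (-1) * fst p + (-2) * snd p \<le> ?B}
    \<inter> {p. 1 * fst p + 0 * snd p \<le> ?B} \<inter> {p. (-1) * fst p + 0 * snd p \<le> ?B}"
  have K: "(x, y) \<in> K \<longleftrightarrow> \<bar>x + y\<bar> \<le> ?A \<and> \<bar>y\<bar> \<le> ?A \<and> \<bar>x + y\<bar> + \<bar>y\<bar> \<le> ?B" for x y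
    unfolding K_def by auto
  have "convex K"
    unfolding K_def by (intro convex_Int convex_halfplane)
  have "real_weight \<mu> \<in> K" if "\<mu> \<in> weyl_orbit (n1, n2)" for \<mu>
  proof -
    obtain k1 k2 where "\<mu> = (k1, k2)"
      by (cases \<mu>) auto
    with weyl_orbit_bounds[of n1 n2 k1 k2] n that show ?thesis
      by (simp add: real_weight_def K flip: of_int_add of_int_abs)
  qed
  then have sub: "?H \<subseteq> K"
    using \<open>convex K\<close> by (intro hull_minimal) auto
  have "real_weight (m1, m2) \<in> ?H \<longleftrightarrow>
    \<bar>m1 + m2\<bar> \<le> n1 + n2 \<and> \<bar>m2\<bar> \<le> n1 + n2 \<and> \<bar>m1 + m2\<bar> + \<bar>m2\<bar> \<le> n1 + 2 * n2" (is "_ \<longleftrightarrow> ?R")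
  proof
    assume "real_weight (m1, m2) \<in> ?H"
    then show ?R
      using sub by (auto simp: real_weight_def K simp flip: of_int_add of_int_abs dest!: subsetD)
  next
    assume ?R
    define C where "C = (\<lambda>p :: real \<times> real. (fst p - snd p, snd p)) -` ?H"
    have lin: "linear (\<lambda>p :: real \<times> real. (fst p - snd p, snd p))"
      by (rule linearI) (auto simp: algebra_simps)
    have "convex C"
      unfolding C_def by (rule convex_linear_vimage[OF lin convex_convex_hull])
    have signs: "\<exists>j::int. \<sigma> = of_int j \<and> \<bar>j\<bar> = 1" if "\<bar>\<sigma>\<bar> = 1" for \<sigma> :: real
      using that by (intro exI[of _ "if \<sigma> = 1 then 1 else - 1"]) (auto simp: abs_if split: if_splits)
    have in_C: "(real_of_int u, real_of_int v) \<in> C" if "(u - v, v) \<in> weyl_orbit (n1, n2)" for u v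
    proof -
      have "real_weight (u - v, v) \<in> ?H"
        using that by (intro hull_inc imageI)
      then show ?thesis
        by (simp add: C_def real_weight_def)
    qed
    have "(real_of_int (m1 + m2), real_of_int m2) \<in> C"
    proof (rule convex_octagon[OF \<open>convex C\<close>, of "real_of_int (n1 + n2)" "real_of_int n2"])
      fix \<sigma> \<tau> :: real assume "\<bar>\<sigma>\<bar> = 1" "\<bar>\<tau>\<bar> = 1"
      then obtain i j :: int where ij: "\<sigma> = of_int i" "\<tau> = of_int j" "\<bar>i\<bar> = 1" "\<bar>j\<bar> = 1"
        using signs by metis
      show "(\<sigma> * real_of_int (n1 + n2), \<tau> * real_of_int n2) \<in> C"
        "(\<sigma> * real_of_int n2, \<tau> * real_of_int (n1 + n2)) \<in> C"
        using in_C[OF weyl_orbit_vertices(1)[OF ij(3,4)]] in_C[OF weyl_orbit_vertices(2)[OF ij(3,4)]]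
        by (simp_all add: ij)
    qed (use \<open>?R\<close> n in linarith)+
    then show "real_weight (m1, m2) \<in> ?H"
      by (simp add: C_def real_weight_def)
  qed
  then show ?thesis
    by (simp add: weight_le_def root_lattice_iff)
qed

section \<open>The complement of the image\<close>

text \<open>
  Smallest number of \<open>\<alpha>\<^sub>2\<close> subtracted from \<open>(l1, n)\<close> among the weights below it with \<open>x\<close> times
  \<open>\<alpha>\<^sub>1\<close> subtracted.
\<close>

definition low :: "nat \<Rightarrow> nat \<Rightarrow> nat \<Rightarrow> nat" where
  "low l1 n x = max ((x + 1 - l1) div 2) (x - (l1 + n))"

lemma abs_add_abs_le_iff:
  fixes p q r :: int
  shows "\<bar>p\<bar> + \<bar>q\<bar> \<le> r \<longleftrightarrow> p + q \<le> r \<and> p - q \<le> r \<and> q - p \<le> r \<and> - p - q \<le> r"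
  by linarith

lemma weight_le_wt_iff:
  "weight_le (int l1 - 2 * x + 2 * y, int n + x - 2 * y) (int l1, int n) \<longleftrightarrow>
    0 \<le> x \<and> x \<le> 2 * (int l1 + int n) \<and> x - int l1 \<le> 2 * y \<and> x - int l1 - int n \<le> y \<and> 0 \<le> y \<and>
    2 * y \<le> 2 * int n + x + int l1 \<and> y \<le> int n + x \<and> y \<le> 2 * int n + int l1"
proof -
  have "int l1 - 2 * x + 2 * y + (int n + x - 2 * y) = int l1 + int n - x"
    by simp
  then show ?thesis
    unfolding weight_le_iff[OF of_nat_0_le_iff of_nat_0_le_iff] abs_add_abs_le_iff abs_le_iff by auto
qed

text \<open>The lower boundary of the octagon has slopes 0, 1/2 and 1; the middle one splits by
  parity. The formulas overlap where two sides meet.\<close>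

lemma low_eqs:
  "x \<le> l1 \<Longrightarrow> low l1 n x = 0"
  "k \<le> n \<Longrightarrow> low l1 n (l1 + 2 * k) = k"
  "k \<le> n \<Longrightarrow> low l1 n (l1 + (2 * k + 1)) = k + 1"
  "n \<le> k \<Longrightarrow> low l1 n (l1 + n + k) = k"
  by (auto simp: low_def max_def)

text \<open>Put x = b + d and y = a + c. For fixed x the reflection s_2 sends y to n + x - y, so the
  weights below run over \<open>low \<le> y \<le> n + x - low\<close>. With \<open>c = low\<close>
  this says exactly \<open>a \<ge> 0\<close> and \<open>a + 2 c \<le> n + x\<close>. It remains that
  \<open>Q\<close> offers one pair (b, d) for each x, valid for all such a.\<close>

lemma bij_betw_string_wt:
  assumes sub: "\<And>a b c d. (a, b, c, d) \<in> Q \<Longrightarrow>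
      b + d \<le> 2 * (l1 + n) \<and> c = low l1 n (b + d) \<and> a + 2 * c \<le> n + (b + d)"
    and uniq: "\<And>a b c d a' b' c' d'. (a, b, c, d) \<in> Q \<Longrightarrow> (a', b', c', d') \<in> Q \<Longrightarrow>
      b + d = b' + d' \<Longrightarrow> b = b'"
    and ex: "\<And>x a. x \<le> 2 * (l1 + n) \<Longrightarrow> a + 2 * low l1 n x \<le> n + x \<Longrightarrow>
      \<exists>b d. b + d = x \<and> (a, b, low l1 n x, d) \<in> Q"
  shows "bij_betw (string_wt l1 n) Q {\<mu>. weight_le \<mu> (int l1, int n)}"
proof (rule bij_betw_imageI)
  show "inj_on (string_wt l1 n) Q"
  proof (rule inj_onI)
    fix x x' assume "x \<in> Q" "x' \<in> Q" and eq: "string_wt l1 n x = string_wt l1 n x'"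
    moreover obtain a b c d a' b' c' d' where x: "x = (a, b, c, d)" "x' = (a', b', c', d')"
      by (cases x, cases x') auto
    ultimately have Q: "(a, b, c, d) \<in> Q" "(a', b', c', d') \<in> Q"
      by auto
    have bd: "b + d = b' + d'" and ac: "a + c = a' + c'"
      using eq by (auto simp: x string_wt_def)
    have "b = b'"
      using uniq[OF Q bd] .
    moreover have "c = c'"
      using sub[OF Q(1)] sub[OF Q(2)] bd by simp
    ultimately show "x = x'"
      using bd ac by (simp add: x)
  qed
  show "string_wt l1 n ` Q = {\<mu>. weight_le \<mu> (int l1, int n)}"
  proof (intro equalityI subsetI)
    fix \<mu> assume "\<mu> \<in> string_wt l1 n ` Q"
    then obtain a b c d where Q: "(a, b, c, d) \<in> Q" and \<mu>: "\<mu> = string_wt l1 n (a, b, c, d)"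
      by auto
    define x where "x = b + d"
    have x: "x \<le> 2 * (l1 + n)" "a + 2 * c \<le> n + x"
      using sub[OF Q] by (auto simp: x_def)
    have "x \<le> 2 * c + l1" "x \<le> c + l1 + n"
      using sub[OF Q] unfolding x_def low_def by linarith+
    then have c: "int x \<le> 2 * int c + int l1" "int x \<le> int c + int l1 + int n" "0 \<le> int a" "0 \<le> int c"
      by linarith+
    have \<mu>: "\<mu> = (int l1 - 2 * int x + 2 * (int a + int c), int n + int x - 2 * (int a + int c))"
      by (simp add: \<mu> x_def string_wt_def)
    have "0 \<le> int x" "int x \<le> 2 * (int l1 + int n)" "int x - int l1 \<le> 2 * (int a + int c)"
      "int x - int l1 - int n \<le> int a + int c" "0 \<le> int a + int c"
      "2 * (int a + int c) \<le> 2 * int n + int x + int l1"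
      "int a + int c \<le> int n + int x" "int a + int c \<le> 2 * int n + int l1"
      using x c by auto
    then show "\<mu> \<in> {\<mu>. weight_le \<mu> (int l1, int n)}"
      unfolding mem_Collect_eq \<mu> weight_le_wt_iff by blast
  next
    fix \<mu> assume "\<mu> \<in> {\<mu>. weight_le \<mu> (int l1, int n)}"
    moreover obtain m1 m2 where \<mu>: "\<mu> = (m1, m2)"
      by (cases \<mu>) auto
    ultimately have le: "weight_le (m1, m2) (int l1, int n)"
      by simp
    then have "even (m1 - int l1)"
      by (simp add: weight_le_iff)
    then obtain j where j: "m1 - int l1 = 2 * j" ..
    define X Y where "X = int l1 + int n - (m1 + m2)" and "Y = j + X"
    have m: "m1 = int l1 - 2 * X + 2 * Y" "m2 = int n + X - 2 * Y"
      using j by (simp_all add: X_def Y_def)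
    note oct = le[unfolded m weight_le_wt_iff]
    define x y where "x = nat X" and "y = nat Y"
    have XY: "X = int x" "Y = int y"
      using oct by (simp_all add: x_def y_def)
    have x: "x \<le> 2 * (l1 + n)" and xy: "x \<le> 2 * y + l1" "x \<le> y + l1 + n"
        "2 * y \<le> 2 * n + x + l1" "y \<le> n + x" "y \<le> 2 * n + l1"
      using oct unfolding XY by auto
    have lowy: "low l1 n x \<le> y" "y + low l1 n x \<le> n + x"
      using x xy unfolding low_def by auto
    then have "(y - low l1 n x) + 2 * low l1 n x \<le> n + x"
      by simp
    from ex[OF x this] obtain b d where bd: "b + d = x" "(y - low l1 n x, b, low l1 n x, d) \<in> Q"
      by blast
    have "string_wt l1 n (y - low l1 n x, b, low l1 n x, d) = \<mu>"
      using bd(1) lowy(1) by (auto simp: string_wt_def \<mu> m XY)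
    then show "\<mu> \<in> string_wt l1 n ` Q"
      using bd(2) by blast
  qed
qed

text \<open>In terms of x = b + d, the four families cover \<open>x \<le> l1\<close>, the even and
  the odd values of x - l1 up to \<open>2 * Suc l2 + 1\<close>, and the values beyond. Each x thus
  determines the pair (b, d).\<close>

lemma psi_complement:
  assumes "0 < l1"
  shows "(a, b, c, d) \<in> pre_strings l1 (Suc l2) - psi l1 ` pre_strings l1 l2 \<longleftrightarrow>
    a + 2 * c \<le> Suc l2 + (b + d) \<and>
    (d = 0 \<and> c = 0 \<and> b \<le> l1 \<or> d = 0 \<and> b = l1 + 2 * c \<and> c \<le> Suc l2 \<or>
     d = 1 \<and> b + 2 = l1 + 2 * c \<and> 1 \<le> c \<and> c \<le> Suc l2 + 1 \<or>
     2 \<le> d \<and> d \<le> l1 \<and> c = Suc l2 + d \<and> b = l1 + 2 * Suc l2)" (is "_ \<longleftrightarrow> ?R")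
proof -
  have image: "(a, b, c, d) \<in> psi l1 ` pre_strings l1 l2 \<longleftrightarrow>
    (d = 0 \<or> d = l1) \<and> 1 \<le> b \<and> 1 \<le> c \<and> (a, b - 1, c - 1, d) \<in> pre_strings l1 l2 \<or>
    1 \<le> c \<and> 2 \<le> d \<and> d \<le> l1 \<and> (a, b, c - 1, d - 1) \<in> pre_strings l1 l2" (is "_ \<longleftrightarrow> ?S")
  proof
    assume "(a, b, c, d) \<in> psi l1 ` pre_strings l1 l2"
    then obtain a' b' c' d' where pre: "(a', b', c', d') \<in> pre_strings l1 l2"
      and eq: "(a, b, c, d) = psi l1 (a', b', c', d')"
      by auto
    have "d' \<le> l1"
      using pre by (simp add: pre_strings_def strings_def)
    then show ?S
      using pre eq by (cases "d' = 0 \<or> d' = l1") (simp_all add: psi_def)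
  next
    assume ?S
    then show "(a, b, c, d) \<in> psi l1 ` pre_strings l1 l2"
    proof
      assume "(d = 0 \<or> d = l1) \<and> 1 \<le> b \<and> 1 \<le> c \<and> (a, b - 1, c - 1, d) \<in> pre_strings l1 l2"
      then show ?thesis
        by (intro image_eqI[of _ _ "(a, b - 1, c - 1, d)"]) (auto simp: psi_def)
    next
      assume "1 \<le> c \<and> 2 \<le> d \<and> d \<le> l1 \<and> (a, b, c - 1, d - 1) \<in> pre_strings l1 l2"
      then show ?thesis
        by (intro image_eqI[of _ _ "(a, b, c - 1, d - 1)"]) (auto simp: psi_def)
    qed
  qed
  have "(a, b, c, d) \<in> pre_strings l1 (Suc l2) \<and> \<not> ?S \<longleftrightarrow> ?R"
  proof -
    \<comment> \<open>For \<open>l1 = 1\<close> the value \<open>d = 1\<close> equals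
      \<open>l1\<close> and is reached by the first branch of \<open>psi\<close>; for
      \<open>l1 > 1\<close> no image has \<open>d = 1\<close>.\<close>
    consider "d = 0" | "d = 1" "l1 = 1" | "d = 1" "1 < l1" | "2 \<le> d" "d < l1" | "2 \<le> d" "d = l1" | "l1 < d"
      using assms by (cases "d = 0"; cases "d = 1"; cases "l1 = 1"; cases "d < l1"; cases "d = l1") auto
    then show ?thesis
    proof cases
      case 1
      then show ?thesis
        using assms unfolding pre_strings_def strings_def by (cases c; cases b) auto
    next
      case 2
      then show ?thesis
        unfolding pre_strings_def strings_def by (cases c; cases b) auto
    next
      case 3
      then show ?thesis
        unfolding pre_strings_def strings_def by auto
    next
      case 4
      then obtain d' where "d = Suc d'"
        by (cases d) auto
      then show ?thesis
        using 4 unfolding pre_strings_def strings_def by (cases c) auto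
    next
      case 5
      then obtain d' where "d = Suc d'"
        by (cases d) auto
      then show ?thesis
        using 5 unfolding pre_strings_def strings_def by (cases c; cases b) auto
    next
      case 6
      then show ?thesis
        using assms unfolding pre_strings_def strings_def by auto
    qed
  qed
  then show ?thesis
    unfolding Diff_iff image .
qed

lemma psi_complement_bounds:
  assumes "0 < l1" "(a, b, c, d) \<in> pre_strings l1 (Suc l2) - psi l1 ` pre_strings l1 l2"
  shows "b + d \<le> 2 * (l1 + Suc l2) \<and> c = low l1 (Suc l2) (b + d) \<and> a + 2 * c \<le> Suc l2 + (b + d)"
  using assms(2) unfolding psi_complement[OF assms(1)]
proof (elim conjE disjE)
  assume "d = 0" "c = 0" "b \<le> l1" "a + 2 * c \<le> Suc l2 + (b + d)"
  then show ?thesis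
    by (simp add: low_eqs)
next
  assume "d = 0" "b = l1 + 2 * c" "c \<le> Suc l2" "a + 2 * c \<le> Suc l2 + (b + d)"
  then show ?thesis
    by (simp add: low_eqs)
next
  assume *: "d = 1" "b + 2 = l1 + 2 * c" "1 \<le> c" "c \<le> Suc l2 + 1" "a + 2 * c \<le> Suc l2 + (b + d)"
  then obtain k where k: "c = k + 1"
    by (cases c) auto
  then have "b + d = l1 + (2 * k + 1)"
    using * by simp
  then have "low l1 (Suc l2) (b + d) = k + 1"
    using low_eqs(3)[of k "Suc l2" l1] k * by simp
  then show ?thesis
    using k * assms(1) by simp
next
  assume *: "2 \<le> d" "d \<le> l1" "c = Suc l2 + d" "b = l1 + 2 * Suc l2" "a + 2 * c \<le> Suc l2 + (b + d)"
  then have "b + d = l1 + Suc l2 + c"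
    by simp
  moreover have "low l1 (Suc l2) (l1 + Suc l2 + c) = c"
    using * by (intro low_eqs) simp
  ultimately have "c = low l1 (Suc l2) (b + d)"
    by metis
  moreover have "b + d \<le> 2 * (l1 + Suc l2)"
    using * by simp
  ultimately show ?thesis
    using *(5) by blast
qed

lemma psi_complement_bij:
  assumes "0 < l1"
  shows "bij_betw (string_wt l1 (Suc l2)) (pre_strings l1 (Suc l2) - psi l1 ` pre_strings l1 l2)
    {\<mu>. weight_le \<mu> (int l1, int (Suc l2))}"
proof (rule bij_betw_string_wt)
  fix a b c d
  assume "(a, b, c, d) \<in> pre_strings l1 (Suc l2) - psi l1 ` pre_strings l1 l2"
  then show "b + d \<le> 2 * (l1 + Suc l2) \<and> c = low l1 (Suc l2) (b + d) \<and> a + 2 * c \<le> Suc l2 + (b + d)"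
    by (rule psi_complement_bounds[OF assms])
next
  fix a b c d a' b' c' d'
  assume Q: "(a, b, c, d) \<in> pre_strings l1 (Suc l2) - psi l1 ` pre_strings l1 l2"
    "(a', b', c', d') \<in> pre_strings l1 (Suc l2) - psi l1 ` pre_strings l1 l2" and bd: "b + d = b' + d'"
  have "c = c'"
    using psi_complement_bounds[OF assms Q(1)] psi_complement_bounds[OF assms Q(2)] bd by simp
  then show "b = b'"
    using Q bd unfolding psi_complement[OF assms] by (elim conjE disjE) linarith+
next
  fix x a
  assume x: "x \<le> 2 * (l1 + Suc l2)" and a: "a + 2 * low l1 (Suc l2) x \<le> Suc l2 + x"
  define c where "c = low l1 (Suc l2) x"
  \<comment> \<open>The value \<open>x = l1 + 2 * Suc l2 + 1\<close> still belongs to the odd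
    family: \<open>d = 1\<close> loosens the bound \<open>c \<le> Suc l2 + d\<close> by one.\<close>
  consider "x \<le> l1" | "l1 < x" "x \<le> l1 + 2 * Suc l2" "even (x - l1)"
    | "l1 < x" "x \<le> l1 + 2 * Suc l2 + 1" "odd (x - l1)" | "l1 + 2 * Suc l2 + 2 \<le> x"
    by (cases "x = l1 + 2 * Suc l2 + 1") (auto simp: not_less, linarith)
  then have "\<exists>d \<le> x. (a, x - d, c, d) \<in> pre_strings l1 (Suc l2) - psi l1 ` pre_strings l1 l2"
  proof cases
    case 1
    then have "c = 0"
      by (simp add: c_def low_eqs)
    then show ?thesis
      using 1 a c_def unfolding psi_complement[OF assms] by (intro exI[of _ 0]) auto
  next
    case 2
    then obtain k where k: "x = l1 + 2 * k"
      by (metis evenE le_add_diff_inverse less_imp_le)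
    then have "c = k"
      using 2 by (simp add: c_def low_eqs)
    then show ?thesis
      using 2 k a c_def unfolding psi_complement[OF assms] by (intro exI[of _ 0]) auto
  next
    case 3
    then obtain k where k: "x = l1 + (2 * k + 1)"
      by (metis oddE le_add_diff_inverse less_imp_le)
    then have "c = k + 1"
      using 3 low_eqs(3)[of k "Suc l2" l1] by (simp add: c_def)
    then show ?thesis
      using 3 k a c_def unfolding psi_complement[OF assms] by (intro exI[of _ 1]) auto
  next
    case 4
    then have "c = x - (l1 + Suc l2)"
      using low_eqs(4)[of "Suc l2" "x - (l1 + Suc l2)" l1] by (simp add: c_def)
    then show ?thesis
      using 4 x a c_def unfolding psi_complement[OF assms] by (intro exI[of _ "x - (l1 + 2 * Suc l2)"]) auto
  qed
  then show "\<exists>b d. b + d = x \<and> (a, b, low l1 (Suc l2) x, d) \<in> pre_strings l1 (Suc l2) - psi l1 ` pre_strings l1 l2"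
    unfolding c_def by (metis le_add_diff_inverse2)
qed

text \<open>For \<open>l1 = 0\<close> only the first branch of \<open>psi\<close> occurs, so two
  steps shift by (0,2,2,0). Of the inequalities of \<open>pre_strings\<close>, only
  \<open>b \<le> 2 c\<close> is tightened, by two, leaving the layers \<open>b = 2 c\<close> and
  \<open>b = 2 c - 1\<close> for even and odd x.\<close>

lemma psi_psi_complement:
  "(a, b, c, d) \<in> pre_strings 0 (Suc (Suc l2)) - psi 0 ` psi 0 ` pre_strings 0 l2 \<longleftrightarrow>
    d = 0 \<and> a + 2 * c \<le> Suc (Suc l2) + b \<and> c \<le> Suc (Suc l2) \<and> (b = 2 * c \<or> 1 \<le> c \<and> b + 1 = 2 * c)"
proof -
  have "(a, b, c, d) \<in> psi 0 ` psi 0 ` pre_strings 0 l2 \<longleftrightarrow>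
    2 \<le> b \<and> 2 \<le> c \<and> (a, b - 2, c - 2, d) \<in> pre_strings 0 l2" (is "_ \<longleftrightarrow> ?S")
  proof
    assume "(a, b, c, d) \<in> psi 0 ` psi 0 ` pre_strings 0 l2"
    then show ?S
      by (auto simp: psi_def pre_strings_def strings_def split: if_splits)
  next
    assume ?S
    moreover from this have "d = 0"
      by (auto simp: pre_strings_def strings_def)
    ultimately show "(a, b, c, d) \<in> psi 0 ` psi 0 ` pre_strings 0 l2"
      unfolding image_image by (intro image_eqI[of _ _ "(a, b - 2, c - 2, d)"]) (auto simp: psi_def)
  qed
  moreover have "(a, b, c, d) \<in> pre_strings 0 (Suc (Suc l2)) \<and> \<not> ?S \<longleftrightarrow>
    d = 0 \<and> a + 2 * c \<le> Suc (Suc l2) + b \<and> c \<le> Suc (Suc l2) \<and> (b = 2 * c \<or> 1 \<le> c \<and> b + 1 = 2 * c)"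
  proof -
    consider "c = 0" | "c = 1" | k where "c = k + 2"
      by (metis One_nat_def Suc_1 add_2_eq_Suc' old.nat.exhaust)
    then show ?thesis
    proof cases
      case 3
      consider "b \<le> 1" | j where "b = j + 2"
        by (metis add.commute le_Suc_ex linorder_not_less not_less_eq_eq numeral_2_eq_2 One_nat_def)
      then show ?thesis
        using 3 by cases (auto simp: pre_strings_def strings_def)
    qed (auto simp: pre_strings_def strings_def)
  qed
  ultimately show ?thesis
    by blast
qed

lemma psi_psi_complement_bij:
  "bij_betw (string_wt 0 (Suc (Suc l2))) (pre_strings 0 (Suc (Suc l2)) - psi 0 ` psi 0 ` pre_strings 0 l2)
    {\<mu>. weight_le \<mu> (int 0, int (Suc (Suc l2)))}"
proof (rule bij_betw_string_wt)
  fix a b c d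
  assume "(a, b, c, d) \<in> pre_strings 0 (Suc (Suc l2)) - psi 0 ` psi 0 ` pre_strings 0 l2"
  then show "b + d \<le> 2 * (0 + Suc (Suc l2)) \<and> c = low 0 (Suc (Suc l2)) (b + d)
    \<and> a + 2 * c \<le> Suc (Suc l2) + (b + d)"
    unfolding psi_psi_complement low_def by auto
next
  fix a b c d a' b' c' d'
  assume "(a, b, c, d) \<in> pre_strings 0 (Suc (Suc l2)) - psi 0 ` psi 0 ` pre_strings 0 l2"
    "(a', b', c', d') \<in> pre_strings 0 (Suc (Suc l2)) - psi 0 ` psi 0 ` pre_strings 0 l2" "b + d = b' + d'"
  then show "b = b'"
    unfolding psi_psi_complement by auto
next
  fix x a
  assume x: "x \<le> 2 * (0 + Suc (Suc l2))" and a: "a + 2 * low 0 (Suc (Suc l2)) x \<le> Suc (Suc l2) + x"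
  \<comment> \<open>With \<open>l1 = 0\<close> the side of slope 1 has degenerated:
    \<open>x \<le> 2 n\<close> makes x - n at most x / 2.\<close>
  have "low 0 (Suc (Suc l2)) x = (x + 1) div 2"
    using x by (auto simp: low_def)
  then have "(a, x, low 0 (Suc (Suc l2)) x, 0) \<in> pre_strings 0 (Suc (Suc l2)) - psi 0 ` psi 0 ` pre_strings 0 l2"
    using x a unfolding psi_psi_complement by (cases "even x") (auto elim!: evenE oddE)
  then show "\<exists>b d. b + d = x \<and> (a, b, low 0 (Suc (Suc l2)) x, d)
      \<in> pre_strings 0 (Suc (Suc l2)) - psi 0 ` psi 0 ` pre_strings 0 l2"
    by (intro exI[of _ x] exI[of _ 0]) simp
qed

section \<open>Symmetrisation\<close>

lemma fst_refl_I1: "fst (refl I1 \<mu>) = - fst \<mu>" "refl I1 (refl I1 \<mu>) = \<mu>"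
  by (cases \<mu>; simp)+

text \<open>Kept general in \<open>F\<close>, because for \<lambda>_1 = 0 it is applied to a
  composite of two maps.\<close>

definition symmetrise :: "(word \<Rightarrow> word) \<Rightarrow> word \<Rightarrow> word" where
  "symmetrise F T = (if fst (wt T) \<le> 0 then F T else s1_crystal (F (s1_crystal T)))"

lemma Psi_bar_symmetrise: "Psi_bar lam = symmetrise (Psi_map lam)"
  by (simp add: fun_eq_iff Psi_bar_def symmetrise_def)

context
  fixes l1 l2 n :: nat and F :: "word \<Rightarrow> word"
  assumes F: "\<And>T. T \<in> pre_tableaux l1 l2 \<Longrightarrow> F T \<in> pre_tableaux l1 n"
    and F_wt: "\<And>T. T \<in> pre_tableaux l1 l2 \<Longrightarrow> wt (F T) = wt T"
begin

lemma symmetrise_mem_wt: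
  assumes "T \<in> pre_tableaux l1 l2"
  shows "symmetrise F T \<in> pre_tableaux l1 n \<and> wt (symmetrise F T) = wt T"
proof -
  note s1 = s1_crystal_pre_tableaux[OF assms]
  note s1_F = s1_crystal_pre_tableaux[OF F[OF s1(1)]]
  show ?thesis
    using assms s1 s1_F by (simp add: symmetrise_def F F_wt fst_refl_I1)
qed

lemma symmetrise_inj_on:
  assumes "inj_on F (pre_tableaux l1 l2)"
  shows "inj_on (symmetrise F) (pre_tableaux l1 l2)"
proof (rule inj_onI)
  fix T U assume T: "T \<in> pre_tableaux l1 l2" and U: "U \<in> pre_tableaux l1 l2"
    and eq: "symmetrise F T = symmetrise F U"
  then have wt: "wt T = wt U"
    using symmetrise_mem_wt by metis
  note s1_T = s1_crystal_pre_tableaux[OF T] and s1_U = s1_crystal_pre_tableaux[OF U]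
  show "T = U"
  proof (cases "fst (wt T) \<le> 0")
    case True
    then have "F T = F U"
      using eq wt by (simp add: symmetrise_def)
    then show ?thesis
      using assms T U by (auto dest: inj_onD)
  next
    case False
    then have "s1_crystal (F (s1_crystal T)) = s1_crystal (F (s1_crystal U))"
      using eq wt by (simp add: symmetrise_def)
    then have "F (s1_crystal T) = F (s1_crystal U)"
      using s1_crystal_pre_tableaux(2) F s1_T(1) s1_U(1) by metis
    then have "s1_crystal T = s1_crystal U"
      using assms s1_T(1) s1_U(1) by (auto dest: inj_onD)
    then show ?thesis
      using s1_T(2) s1_U(2) by metis
  qed
qed

lemma symmetrise_image_iff:
  assumes U: "U \<in> pre_tableaux l1 n"
  shows "U \<in> symmetrise F ` pre_tableaux l1 l2 \<longleftrightarrow>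
    (if fst (wt U) \<le> 0 then U else s1_crystal U) \<in> F ` pre_tableaux l1 l2"
proof (cases "fst (wt U) \<le> 0")
  case True
  have "U \<in> symmetrise F ` pre_tableaux l1 l2 \<longleftrightarrow> U \<in> F ` pre_tableaux l1 l2"
  proof
    assume "U \<in> symmetrise F ` pre_tableaux l1 l2"
    then obtain T where T: "T \<in> pre_tableaux l1 l2" "U = symmetrise F T"
      by blast
    then have "U = F T"
      using symmetrise_mem_wt[OF T(1)] True by (simp add: symmetrise_def)
    then show "U \<in> F ` pre_tableaux l1 l2"
      using T(1) by blast
  next
    assume "U \<in> F ` pre_tableaux l1 l2"
    then obtain T where T: "T \<in> pre_tableaux l1 l2" "U = F T"
      by blast
    then have "U = symmetrise F T"
      using F_wt[OF T(1)] True by (simp add: symmetrise_def)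
    then show "U \<in> symmetrise F ` pre_tableaux l1 l2"
      using T(1) by blast
  qed
  then show ?thesis
    using True by simp
next
  case False
  have "U \<in> symmetrise F ` pre_tableaux l1 l2 \<longleftrightarrow> s1_crystal U \<in> F ` pre_tableaux l1 l2"
  proof
    assume "U \<in> symmetrise F ` pre_tableaux l1 l2"
    then obtain T where T: "T \<in> pre_tableaux l1 l2" "U = symmetrise F T"
      by blast
    then have "U = s1_crystal (F (s1_crystal T))"
      using symmetrise_mem_wt[OF T(1)] False by (simp add: symmetrise_def)
    then have "s1_crystal U = F (s1_crystal T)"
      using s1_crystal_pre_tableaux(2)[OF F[OF s1_crystal_pre_tableaux(1)[OF T(1)]]] by simp
    then show "s1_crystal U \<in> F ` pre_tableaux l1 l2"
      using s1_crystal_pre_tableaux(1)[OF T(1)] by blast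
  next
    assume "s1_crystal U \<in> F ` pre_tableaux l1 l2"
    then obtain T where T: "T \<in> pre_tableaux l1 l2" "s1_crystal U = F T"
      by blast
    then have "wt T = refl I1 (wt U)"
      using F_wt[OF T(1)] s1_crystal_pre_tableaux(3)[OF U] by simp
    then have "symmetrise F (s1_crystal T) = s1_crystal (F T)"
      using T(1) False by (simp add: symmetrise_def s1_crystal_pre_tableaux fst_refl_I1)
    then have "U = symmetrise F (s1_crystal T)"
      using T(2) s1_crystal_pre_tableaux(2)[OF U] by metis
    then show "U \<in> symmetrise F ` pre_tableaux l1 l2"
      using s1_crystal_pre_tableaux(1)[OF T(1)] by blast
  qed
  then show ?thesis
    using False by simp
qed

lemma bij_betw_wt_symmetrise:
  assumes bij: "bij_betw wt (pre_tableaux l1 n - F ` pre_tableaux l1 l2) M"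
    and M: "\<And>\<mu>. \<mu> \<in> M \<Longrightarrow> refl I1 \<mu> \<in> M"
  shows "bij_betw wt (pre_tableaux l1 n - symmetrise F ` pre_tableaux l1 l2) M"
proof -
  let ?A = "pre_tableaux l1 n - F ` pre_tableaux l1 l2"
  let ?B = "pre_tableaux l1 n - symmetrise F ` pre_tableaux l1 l2"
  define g where "g U = (if fst (wt U) \<le> 0 then U else s1_crystal U)" for U
  have g: "g U \<in> ?A \<longleftrightarrow> U \<in> ?B" if "U \<in> pre_tableaux l1 n" for U
    using that symmetrise_image_iff[OF that] s1_crystal_pre_tableaux(1)[OF that] by (auto simp: g_def)
  have inj: "inj_on wt ?A" and img: "wt ` ?A = M"
    using bij by (auto simp: bij_betw_def)
  show ?thesis
  proof (rule bij_betw_imageI)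
    show "inj_on wt ?B"
    proof (rule inj_onI)
      fix U U' assume U: "U \<in> ?B" "U' \<in> ?B" and wt: "wt U = wt U'"
      then have P: "U \<in> pre_tableaux l1 n" "U' \<in> pre_tableaux l1 n"
        by auto
      have "wt (g U) = wt (g U')"
        using wt P by (simp add: g_def s1_crystal_pre_tableaux)
      then have "g U = g U'"
        using g[OF P(1)] g[OF P(2)] U inj by (meson inj_onD)
      \<comment> \<open>Equal weights put both elements in the same branch of \<open>g\<close>, and
        reversal is an involution.\<close>
      then show "U = U'"
        using wt P s1_crystal_pre_tableaux(2) unfolding g_def by metis
    qed
    show "wt ` ?B = M"
    proof (intro equalityI subsetI)
      fix \<mu> assume "\<mu> \<in> wt ` ?B"
      then obtain U where U: "U \<in> ?B" "\<mu> = wt U"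
        by blast
      then have "wt (g U) \<in> M"
        using g[of U] img by blast
      then show "\<mu> \<in> M"
        using U M[of "refl I1 \<mu>"] by (auto simp: g_def s1_crystal_pre_tableaux fst_refl_I1 split: if_splits)
    next
      fix \<mu> assume \<mu>: "\<mu> \<in> M"
      show "\<mu> \<in> wt ` ?B"
      proof (cases "fst \<mu> \<le> 0")
        case True
        obtain U where U: "U \<in> ?A" "wt U = \<mu>"
          using \<mu> img by blast
        then have "U \<in> ?B"
          using g[of U] True by (auto simp: g_def)
        then show ?thesis
          using U(2) by blast
      next
        case False
        obtain U where U: "U \<in> ?A" "wt U = refl I1 \<mu>"
          using M[OF \<mu>] img by (metis imageE)
        then have P: "U \<in> pre_tableaux l1 n"
          by blast
        note s1 = s1_crystal_pre_tableaux[OF P]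
        have wt: "wt (s1_crystal U) = \<mu>"
          by (simp add: s1(3) U(2) fst_refl_I1)
        then have "g (s1_crystal U) = U"
          using False s1(2) by (simp add: g_def)
        then have "s1_crystal U \<in> ?B"
          using g[OF s1(1)] U(1) by simp
        then show ?thesis
          using wt by blast
      qed
    qed
  qed
qed

end

section \<open>From strings back to the crystal\<close>

lemma bij_betw_wt_complement:
  assumes "A \<subseteq> pre_tableaux l1 n" "str2 ` A = Q"
    and "bij_betw (string_wt l1 n) (pre_strings l1 n - Q) M"
  shows "bij_betw wt (pre_tableaux l1 n - A) M"
proof -
  have inj: "inj_on str2 (pre_tableaux l1 n)" and img: "str2 ` pre_tableaux l1 n = pre_strings l1 n"
    using bij_betw_str2 by (auto simp: bij_betw_def)
  have "str2 ` (pre_tableaux l1 n - A) = pre_strings l1 n - Q"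
    using inj_on_image_set_diff[OF inj, of "pre_tableaux l1 n" A] assms(1,2) img by auto
  then have "bij_betw str2 (pre_tableaux l1 n - A) (pre_strings l1 n - Q)"
    using inj_on_subset[OF inj] by (auto simp: bij_betw_def)
  from bij_betw_trans[OF this assms(3)] show ?thesis
    by (rule bij_betw_cong[THEN iffD1, rotated]) (auto simp: pre_tableaux_def wt_eq_string_wt)
qed

lemma refl_weight_le:
  "\<mu> \<in> {\<mu>. weight_le \<mu> (int l1, int n)} \<Longrightarrow> refl I1 \<mu> \<in> {\<mu>. weight_le \<mu> (int l1, int n)}"
  by (cases \<mu>) (auto simp: weight_le_iff)

lemma is_atomI:
  assumes "A \<subseteq> pre_tableaux l1 n" "bij_betw wt A {\<mu>. weight_le \<mu> (int l1, int n)}"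
  shows "is_atom (int l1, int n) A"
proof -
  have "A \<subseteq> crystal (int l1, int n)" "(int l1, int n) \<in> dominant"
    using assms(1) by (auto simp: crystal_eq_tableaux pre_tableaux_def dominant_def)
  then show ?thesis
    using assms(2) unfolding is_atom_def by blast
qed

theorem proposition3p16:
  fixes lam :: weight
  assumes "lam \<in> dominant"
  shows "Psi_bar lam ` preatom lam \<subseteq> preatom (lam + varpi2)
    \<and> inj_on (Psi_bar lam) (preatom lam)
    \<and> (\<forall>T \<in> preatom lam. wt (Psi_bar lam T) = wt T)
    \<and> (fst lam \<noteq> 0 \<longrightarrow>
         is_atom (lam + varpi2) (preatom (lam + varpi2) - Psi_bar lam ` preatom lam))
    \<and> (fst lam = 0 \<longrightarrow>
         is_atom (lam + varpi2 + varpi2)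
           (preatom (lam + varpi2 + varpi2)
              - (Psi_bar (lam + varpi2) \<circ> Psi_bar lam) ` preatom lam))"
proof -
  define l1 l2 where "l1 = nat (fst lam)" and "l2 = nat (snd lam)"
  have lam: "lam = (int l1, int l2)"
    using assms by (cases lam) (auto simp: dominant_def l1_def l2_def)
  note Psi = Psi_map_string(1) wt_Psi_map
  let ?P = "pre_tableaux l1" and ?Psi = "\<lambda>n. Psi_map (int l1, int n)"
  have mem_wt: "symmetrise (?Psi n) T \<in> ?P (Suc n) \<and> wt (symmetrise (?Psi n) T) = wt T"
    if "T \<in> ?P n" for n T
    by (rule symmetrise_mem_wt[OF Psi that])
  have inj: "inj_on (symmetrise (?Psi l2)) (?P l2)"
    by (rule symmetrise_inj_on[OF Psi inj_on_Psi_map])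
  have img: "str2 ` ?P l2 = pre_strings l1 l2"
    using bij_betw_str2 by (auto simp: bij_betw_def)
  have atom1: "is_atom (int l1, int (Suc l2)) (?P (Suc l2) - symmetrise (?Psi l2) ` ?P l2)" if "0 < l1"
  proof (rule is_atomI)
    have "bij_betw wt (?P (Suc l2) - ?Psi l2 ` ?P l2) {\<mu>. weight_le \<mu> (int l1, int (Suc l2))}"
    proof (rule bij_betw_wt_complement)
      show "str2 ` ?Psi l2 ` ?P l2 = psi l1 ` pre_strings l1 l2"
        using Psi_map_image[OF subset_refl] img by metis
    qed (use Psi(1) psi_complement_bij[OF that] in auto)
    from bij_betw_wt_symmetrise[OF Psi this refl_weight_le]
    show "bij_betw wt (?P (Suc l2) - symmetrise (?Psi l2) ` ?P l2) {\<mu>. weight_le \<mu> (int l1, int (Suc l2))}" .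
  qed blast
  have atom2: "is_atom (int l1, int (Suc (Suc l2)))
      (?P (Suc (Suc l2)) - (symmetrise (?Psi (Suc l2)) \<circ> symmetrise (?Psi l2)) ` ?P l2)" if "l1 = 0"
  proof (rule is_atomI)
    let ?F = "?Psi (Suc l2) \<circ> ?Psi l2"
    have F: "?F T \<in> ?P (Suc (Suc l2))" "wt (?F T) = wt T" if "T \<in> ?P l2" for T
      using Psi[OF that] Psi[OF Psi(1)[OF that]] by simp_all
    have sub: "?Psi l2 ` ?P l2 \<subseteq> ?P (Suc l2)"
      using Psi(1) by blast
    have "bij_betw wt (?P (Suc (Suc l2)) - ?F ` ?P l2) {\<mu>. weight_le \<mu> (int l1, int (Suc (Suc l2)))}"
    proof (rule bij_betw_wt_complement)
      show "str2 ` ?F ` ?P l2 = psi l1 ` psi l1 ` pre_strings l1 l2"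
        unfolding image_comp[symmetric] Psi_map_image[OF sub] Psi_map_image[OF subset_refl] img ..
      show "bij_betw (string_wt l1 (Suc (Suc l2)))
          (pre_strings l1 (Suc (Suc l2)) - psi l1 ` psi l1 ` pre_strings l1 l2)
          {\<mu>. weight_le \<mu> (int l1, int (Suc (Suc l2)))}"
        unfolding that by (rule psi_psi_complement_bij)
    qed (use F in auto)
    from bij_betw_wt_symmetrise[OF F this refl_weight_le]
    have "bij_betw wt (?P (Suc (Suc l2)) - symmetrise ?F ` ?P l2) {\<mu>. weight_le \<mu> (int l1, int (Suc (Suc l2)))}" .
    \<comment> \<open>The intermediate element has the same weight, so both factors take the same
      branch; on the reflected half the two inner reversals cancel.\<close>
    moreover have "symmetrise ?F ` ?P l2 = (symmetrise (?Psi (Suc l2)) \<circ> symmetrise (?Psi l2)) ` ?P l2"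
    proof (rule image_cong[OF HOL.refl])
      fix T assume T: "T \<in> ?P l2"
      have "fst (wt (symmetrise (?Psi l2) T)) = fst (wt T)"
        using mem_wt[OF T] by simp
      then show "symmetrise ?F T = (symmetrise (?Psi (Suc l2)) \<circ> symmetrise (?Psi l2)) T"
        using s1_crystal_pre_tableaux(2)[OF Psi(1)[OF s1_crystal_pre_tableaux(1)[OF T]]]
        by (auto simp: symmetrise_def)
    qed
    ultimately show "bij_betw wt (?P (Suc (Suc l2)) - (symmetrise (?Psi (Suc l2)) \<circ> symmetrise (?Psi l2)) ` ?P l2)
        {\<mu>. weight_le \<mu> (int l1, int (Suc (Suc l2)))}"
      by simp
  qed blast
  show ?thesis
    unfolding lam varpi2_add preatom_eq Psi_bar_symmetrise
    using mem_wt inj atom1 atom2 by (auto simp del: of_nat_Suc)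
qed

end
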